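(* Let $n,m\ge1$ be natural numbers and let $f\in L^2(\mathbb{R}_+^n)$ and $g\in L^2(\mathbb{R}_+^m)$ be symmetric functions. Assume that the free Poisson integrals $I_n^{\hat N}(f)$ and $I_m^{\hat N}(g)$ are free. Then the classical Poisson multiple integrals $I_n^{\hat\eta}(f)$ and $I_m^{\hat\eta}(g)$ are moment independent.
   Context: $\mathbb{R}_+=[0,\infty)$ with Lebesgue measure; $L^2(\mathbb{R}_+^n)$ is the space of complex-valued square-integrable functions. A function $f\in L^2(\mathbb{R}_+^n)$ is called symmetric if it is real-valued and $f(t_1,\dots,t_n)=f(t_{\sigma(1)},\dots,t_{\sigma(n)})$ for a.e. $(t_1,\dots,t_n)$ and every permutation $\sigma$. Its adjoint is $f^*(t_1,\dots,t_n)=\overline{f(t_n,\dots,t_1)}$. $I_n^{\hat\eta}(f)$ denotes the classical multiple (Wiener–Itô) integral of order $n$ of $f$ with respect to a (classical) compensated Poisson random measure $\hat\eta$ on $\mathbb{R}_+$ with Lebesgue intensity. Two classical random variables $X,Y$ are moment independent if $E[X^aY^b]=E[X^a]E[Y^b]$ for all natural numbers $a,b$ (the moments being understood to exist). $(\mathscr{A},\varphi)$ is a tracial $W^*$-probability space: $\mathscr{A}$ is a von Neumann algebra and $\varphi:\mathscr{A}\to\mathbb{C}$ is a unital, weakly continuous, positive, faithful, tracial linear functional. $L^2(\mathscr{A},\varphi)$ is the completion of $\mathscr{A}$ for $\|X\|_2=\sqrt{\varphi(XX^* )}$. Freeness: $X_1,\dots,X_d$ are free if $\varphi\big([P_1(X_{i_1})-\varphi(P_1(X_{i_1}))]\cdots[P_r(X_{i_r})-\varphi(P_r(X_{i_r}))]\big)=0$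 whenever $r\ge1$, $P_1,\dots,P_r$ are polynomials and $i_1,\dots,i_r\in\{1,\dots,d\}$ have no two adjacent indices equal. Free Poisson process $N=\{N_t\}_{t\ge0}$: positive elements of $\mathscr{A}$ adapted to an increasing filtration $(\mathscr{A}_t)_{t\ge0}$ of von Neumann subalgebras, with $N_0=0$ and, for $0\le u<t$, $N_t-N_u$ free from $\mathscr{A}_u$ with the free Poisson law of rate $\lambda=t-u$, i.e. $(1-\lambda)\delta_0+\tilde\nu$ if $\lambda\le1$ (with the understanding that $\tilde\nu$ carries mass $\lambda$) and $\tilde\nu$ if $\lambda>1$, where $\tilde\nu(dx)=(2\pi x)^{-1}\sqrt{4\lambda-(x-1-\lambda)^2}\,dx$ on $[(1-\sqrt\lambda)^2,(1+\sqrt\lambda)^2]$. $\hat N_t=N_t-t\mathbf{1}$ is the compensated process. Free Poisson integrals: $I_n^{\hat N}$ is the linear map $L^2(\mathbb{R}_+^n)\to L^2(\mathscr{A},\varphi)$ determined by $I_n^{\hat N}(\mathbf{1}_{[a_1,b_1]\times\cdots\times[a_n,b_n]})=(\hat N_{b_1}-\hat N_{a_1})\cdots(\hat N_{b_n}-\hat N_{a_n})$ for pairwise disjoint intervals and extended by linearity and the isometry $\varphi(I_n^{\hat N}(f)I_n^{\hat N}(g)^* )=\langle f,g\rangle_{L^2(\mathbb{R}_+^n)}$; $I_0^{\hat N}(c)=c\mathbf 1$. Integrals of different orders are orthogonal, and $I_n^{\hat N}(f)^*=I_n^{\hat N}(f^* )$. Contractions, for $f\in L^2(\mathbb{R}_+^n)$,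 $g\in L^2(\mathbb{R}_+^m)$: for $0\le p\le n\wedge m$, $(f\stackrel{p}{\frown}g)(t_1,\dots,t_{n+m-2p})=\int_{\mathbb{R}_+^p}f(t_1,\dots,t_{n-p},s_1,\dots,s_p)\,g(s_p,\dots,s_1,t_{n-p+1},\dots,t_{n+m-2p})\,ds_1\cdots ds_p$; and for $1\le p\le n\wedge m$, $(f\star_p^{p-1}g)(t_1,\dots,t_{n+m-2p+1})=\int_{\mathbb{R}_+^{p-1}}f(t_1,\dots,t_{n-p+1},s_{p-1},\dots,s_1)\,g(s_1,\dots,s_{p-1},t_{n-p+1},\dots,t_{n+m-2p+1})\,ds_1\cdots ds_{p-1}$. Standing convention: the multiple integrals span a unital $*$-algebra, with products (hence moments) computed by $I_n^{\hat N}(f)I_m^{\hat N}(g)=\sum_{p=0}^{n\wedge m}I_{n+m-2p}^{\hat N}(f\stackrel{p}{\frown}g)+\sum_{p=1}^{n\wedge m}I_{n+m-2p+1}^{\hat N}(f\star_p^{p-1}g)$.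
   Formalization: Since star contractions of L² kernels need not be in L², the two free Poisson integrals are assumed to lie in some unital *-algebra spanned by multiple integrals in which all star contractions are square-integrable and the product formula holds. *)

theory Defs
  imports "HOL-Probability.Probability" "HOL-Computational_Algebra.Polynomial"
begin

section \<open>Complex Hilbert spaces and bounded operators\<close>

class scaleC =
  fixes scaleC :: "complex \<Rightarrow> 'a \<Rightarrow> 'a" (infixr \<open>*\<^sub>C\<close> 75)

text \<open>The inner product is linear in the first argument.\<close>

class complex_hilbert = banach + scaleC +
  fixes cinner :: "'a \<Rightarrow> 'a \<Rightarrow> complex"
  assumes scaleC_add_right: "c *\<^sub>C (x + y) = c *\<^sub>C x + c *\<^sub>C y"
    and scaleC_add_left: "(c + d) *\<^sub>C x = c *\<^sub>C x + d *\<^sub>C x"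
    and scaleC_scaleC: "c *\<^sub>C (d *\<^sub>C x) = (c * d) *\<^sub>C x"
    and scaleC_of_real: "complex_of_real r *\<^sub>C x = r *\<^sub>R x"
    and cinner_add_left: "cinner (x + y) z = cinner x z + cinner y z"
    and cinner_scaleC_left: "cinner (c *\<^sub>C x) y = c * cinner x y"
    and cinner_commute: "cinner y x = cnj (cinner x y)"
    and cinner_self: "cinner x x = complex_of_real ((norm x)\<^sup>2)"

instantiation blinfun :: (real_normed_vector, complex_hilbert) scaleC
begin
definition scaleC_blinfun :: "complex \<Rightarrow> ('a \<Rightarrow>\<^sub>L 'b) \<Rightarrow> ('a \<Rightarrow>\<^sub>L 'b)" where
  "c *\<^sub>C T = Blinfun (\<lambda>x. c *\<^sub>C blinfun_apply T x)"
instance ..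
end

lemma norm_scaleC: "norm (c *\<^sub>C x) = cmod c * norm (x :: 'a::complex_hilbert)"
proof -
  have "complex_of_real ((norm (c *\<^sub>C x))\<^sup>2) = c * cnj (c * cinner x x)"
    by (metis cinner_self cinner_scaleC_left cinner_commute)
  also have "\<dots> = complex_of_real ((cmod c * norm x)\<^sup>2)"
    unfolding cinner_self by (simp add: power_mult_distrib complex_norm_square del: of_real_power)
  finally have "(norm (c *\<^sub>C x))\<^sup>2 = (cmod c * norm x)\<^sup>2"
    using of_real_eq_iff by blast
  then show ?thesis by simp
qed

lemma bounded_linear_scaleC: "bounded_linear (\<lambda>x :: 'a::complex_hilbert. c *\<^sub>C x)"
proof (rule bounded_linear_intro[where K = "cmod c"])
  show "c *\<^sub>C (r *\<^sub>R x) = r *\<^sub>R (c *\<^sub>C x)" for r and x :: 'a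
    by (metis scaleC_of_real scaleC_scaleC mult.commute)
qed (simp_all add: scaleC_add_right norm_scaleC mult.commute)

lemma blinfun_apply_scaleC [simp]:
  "blinfun_apply (c *\<^sub>C T) x = c *\<^sub>C blinfun_apply T x"
  unfolding scaleC_blinfun_def
  by (subst bounded_linear_Blinfun_apply)
     (auto intro: bounded_linear_compose[OF bounded_linear_scaleC blinfun.bounded_linear_right])

definition adjoint_pair :: "('h::complex_hilbert \<Rightarrow>\<^sub>L 'h) \<Rightarrow> ('h \<Rightarrow>\<^sub>L 'h) \<Rightarrow> bool" where
  "adjoint_pair T S \<longleftrightarrow>
     (\<forall>x y. cinner (blinfun_apply T x) y = cinner x (blinfun_apply S y))"

definition adj :: "('h::complex_hilbert \<Rightarrow>\<^sub>L 'h) \<Rightarrow> ('h \<Rightarrow>\<^sub>L 'h)" where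
  "adj T = (THE S. adjoint_pair T S)"

definition positive_operator :: "('h::complex_hilbert \<Rightarrow>\<^sub>L 'h) \<Rightarrow> bool" where
  "positive_operator T \<longleftrightarrow>
     (\<forall>x. cinner (blinfun_apply T x) x \<in> \<real> \<and> 0 \<le> Re (cinner (blinfun_apply T x) x))"

definition weak_operator_topology :: "('h::complex_hilbert \<Rightarrow>\<^sub>L 'h) topology" where
  "weak_operator_topology =
     pullback_topology UNIV (\<lambda>T (x, y). cinner (blinfun_apply T x) y) euclidean"

text \<open>The ultraweak (sigma-weak, weak-*) topology: the initial topology of the functionals
  \<open>T \<mapsto> \<Sum>\<^sub>k \<langle>T \<xi>\<^sub>k, \<eta>\<^sub>k\<rangle>\<close> with \<open>\<xi>\<close>, \<open>\<eta>\<close> square-summable sequences of vectors.\<close>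

definition ultraweak_topology :: "('h::complex_hilbert \<Rightarrow>\<^sub>L 'h) topology" where
  "ultraweak_topology =
     pullback_topology UNIV
       (\<lambda>T (\<xi> :: nat \<Rightarrow> 'h, \<eta> :: nat \<Rightarrow> 'h).
          if summable (\<lambda>k. (norm (\<xi> k))\<^sup>2) \<and> summable (\<lambda>k. (norm (\<eta> k))\<^sup>2)
          then (\<Sum>k. cinner (blinfun_apply T (\<xi> k)) (\<eta> k)) else 0)
       euclidean"


section \<open>Tracial \<open>W\<^sup>*\<close>-probability spaces\<close>

text \<open>Operators are a priori only real-linear, hence the condition of complex linearity.\<close>

definition von_neumann_algebra :: "('h::complex_hilbert \<Rightarrow>\<^sub>L 'h) set \<Rightarrow> bool" where
  "von_neumann_algebra A \<longleftrightarrow>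
     (\<forall>T\<in>A. \<forall>c x. blinfun_apply T (c *\<^sub>C x) = c *\<^sub>C blinfun_apply T x) \<and>
     id_blinfun \<in> A \<and>
     (\<forall>S\<in>A. \<forall>T\<in>A. S + T \<in> A \<and> S o\<^sub>L T \<in> A) \<and>
     (\<forall>c. \<forall>T\<in>A. c *\<^sub>C T \<in> A) \<and>
     (\<forall>T\<in>A. \<exists>S\<in>A. adjoint_pair T S) \<and>
     closedin weak_operator_topology A"

text \<open>Weak continuity of the trace is understood in the \<open>W\<^sup>*\<close>-sense, that is, ultraweakly
  (normality); this is implied by continuity for the weak operator topology.\<close>

locale tracial_W_space =
  fixes A :: "('h::complex_hilbert \<Rightarrow>\<^sub>L 'h) set"
    and \<phi> :: "('h \<Rightarrow>\<^sub>L 'h) \<Rightarrow> complex"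
  assumes von_neumann: "von_neumann_algebra A"
    and add: "S \<in> A \<Longrightarrow> T \<in> A \<Longrightarrow> \<phi> (S + T) = \<phi> S + \<phi> T"
    and scaleC: "T \<in> A \<Longrightarrow> \<phi> (c *\<^sub>C T) = c * \<phi> T"
    and unital: "\<phi> id_blinfun = 1"
    and weakly_continuous: "continuous_map (subtopology ultraweak_topology A) euclidean \<phi>"
    and positive: "T \<in> A \<Longrightarrow> positive_operator T \<Longrightarrow> \<phi> T \<in> \<real> \<and> 0 \<le> Re (\<phi> T)"
    and faithful: "T \<in> A \<Longrightarrow> \<phi> (adj T o\<^sub>L T) = 0 \<Longrightarrow> T = 0"
    and tracial: "S \<in> A \<Longrightarrow> T \<in> A \<Longrightarrow> \<phi> (S o\<^sub>L T) = \<phi> (T o\<^sub>L S)"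

text \<open>\<open>L\<^sup>2(A, \<phi>)\<close> is represented by any Hilbert space \<open>'l\<close> with an isometric embedding \<open>\<iota>\<close>
  of \<open>A\<close>, normed by \<open>(\<phi> (T T\<^sup>*))\<^sup>1\<^sup>/\<^sup>2\<close>, as a dense subspace.\<close>

locale L2_completion =
  fixes A :: "('h::complex_hilbert \<Rightarrow>\<^sub>L 'h) set"
    and \<phi> :: "('h \<Rightarrow>\<^sub>L 'h) \<Rightarrow> complex"
    and \<iota> :: "('h \<Rightarrow>\<^sub>L 'h) \<Rightarrow> 'l::complex_hilbert"
  assumes add: "S \<in> A \<Longrightarrow> T \<in> A \<Longrightarrow> \<iota> (S + T) = \<iota> S + \<iota> T"
    and scaleC: "T \<in> A \<Longrightarrow> \<iota> (c *\<^sub>C T) = c *\<^sub>C \<iota> T"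
    and isometric: "S \<in> A \<Longrightarrow> T \<in> A \<Longrightarrow> cinner (\<iota> S) (\<iota> T) = \<phi> (S o\<^sub>L adj T)"
    and dense: "closure (\<iota> ` A) = UNIV"

text \<open>The continuous extensions to \<open>L\<^sup>2(A, \<phi>)\<close> of \<open>\<phi>\<close> and of the involution.\<close>

definition L2_trace :: "(('h::complex_hilbert \<Rightarrow>\<^sub>L 'h) \<Rightarrow> 'l::complex_hilbert) \<Rightarrow> 'l \<Rightarrow> complex"
  where "L2_trace \<iota> Z = cinner Z (\<iota> id_blinfun)"

definition L2_star ::
  "('h::complex_hilbert \<Rightarrow>\<^sub>L 'h) set \<Rightarrow> (('h \<Rightarrow>\<^sub>L 'h) \<Rightarrow> 'l::complex_hilbert) \<Rightarrow> 'l \<Rightarrow> 'l" where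
  "L2_star A \<iota> = (THE J. continuous_on UNIV J \<and> (\<forall>T\<in>A. J (\<iota> T) = \<iota> (adj T)))"


section \<open>Freeness\<close>

text \<open>The multiplication and the unit are parameters, since freeness is needed both for
  bounded operators and in an algebra contained in \<open>L\<^sup>2(A, \<phi>)\<close>.\<close>

definition poly_eval ::
  "('a \<Rightarrow> 'a \<Rightarrow> 'a) \<Rightarrow> 'a \<Rightarrow> complex poly \<Rightarrow> 'a \<Rightarrow> 'a::{comm_monoid_add, scaleC}" where
  "poly_eval mul one p x = (\<Sum>k\<le>degree p. coeff p k *\<^sub>C (mul x ^^ k) one)"

definition polynomials_in ::
  "('a \<Rightarrow> 'a \<Rightarrow> 'a) \<Rightarrow> 'a \<Rightarrow> 'a \<Rightarrow> 'a::{comm_monoid_add, scaleC} set" where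
  "polynomials_in mul one x = range (\<lambda>p. poly_eval mul one p x)"

definition free_family ::
  "('a \<Rightarrow> 'a \<Rightarrow> 'a) \<Rightarrow> 'a \<Rightarrow> ('a \<Rightarrow> complex) \<Rightarrow> ('i \<Rightarrow> 'a::{ab_group_add, scaleC} set) \<Rightarrow> bool" where
  "free_family mul one \<phi> B \<longleftrightarrow>
     (\<forall>zs :: ('i \<times> 'a) list.
        zs \<noteq> [] \<longrightarrow> distinct_adj (map fst zs) \<longrightarrow> (\<forall>(i, z) \<in> set zs. z \<in> B i) \<longrightarrow>
        \<phi> (foldr mul (map (\<lambda>(i, z). z - \<phi> z *\<^sub>C one) zs) one) = 0)"

definition free_elements ::
  "('a \<Rightarrow> 'a \<Rightarrow> 'a) \<Rightarrow> 'a \<Rightarrow> ('a \<Rightarrow> complex) \<Rightarrow> ('i \<Rightarrow> 'a::{ab_group_add, scaleC}) \<Rightarrow> bool" where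
  "free_elements mul one \<phi> X \<longleftrightarrow> free_family mul one \<phi> (\<lambda>i. polynomials_in mul one (X i))"


section \<open>Free Poisson processes\<close>

definition free_poisson_law :: "real \<Rightarrow> real measure" where
  "free_poisson_law r = measure_of UNIV (sets borel)
     (\<lambda>B. ennreal (max 0 (1 - r)) * indicator B 0 +
        emeasure (density lborel (\<lambda>x. ennreal
          (indicator {(1 - sqrt r)\<^sup>2 .. (1 + sqrt r)\<^sup>2} x *
             (sqrt (4 * r - (x - 1 - r)\<^sup>2) / (2 * pi * x))))) B)"

text \<open>For a bounded self-adjoint operator and a compactly supported law, equality of all
  moments characterises the spectral distribution.\<close>

definition has_law ::
  "(('h::complex_hilbert \<Rightarrow>\<^sub>L 'h) \<Rightarrow> complex) \<Rightarrow> ('h \<Rightarrow>\<^sub>L 'h) \<Rightarrow> real measure \<Rightarrow> bool" where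
  "has_law \<phi> T \<mu> \<longleftrightarrow>
     (\<forall>k. integrable \<mu> (\<lambda>x. x ^ k) \<and>
          \<phi> (((o\<^sub>L) T ^^ k) id_blinfun) = complex_of_real (\<integral>x. x ^ k \<partial>\<mu>))"

locale free_poisson_process =
  fixes A :: "('h::complex_hilbert \<Rightarrow>\<^sub>L 'h) set"
    and \<phi> :: "('h \<Rightarrow>\<^sub>L 'h) \<Rightarrow> complex"
    and \<A> :: "real \<Rightarrow> ('h \<Rightarrow>\<^sub>L 'h) set"
    and N :: "real \<Rightarrow> ('h \<Rightarrow>\<^sub>L 'h)"
  assumes filtration: "0 \<le> t \<Longrightarrow> von_neumann_algebra (\<A> t) \<and> \<A> t \<subseteq> A"
    and increasing: "0 \<le> u \<Longrightarrow> u \<le> t \<Longrightarrow> \<A> u \<subseteq> \<A> t"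
    and adapted: "0 \<le> t \<Longrightarrow> N t \<in> \<A> t"
    and positive: "0 \<le> t \<Longrightarrow> positive_operator (N t)"
    and zero: "N 0 = 0"
    and free_increments: "0 \<le> u \<Longrightarrow> u < t \<Longrightarrow>
      free_family (o\<^sub>L) id_blinfun \<phi>
        (\<lambda>b::bool. if b then polynomials_in (o\<^sub>L) id_blinfun (N t - N u) else \<A> u)"
    and law_increments: "0 \<le> u \<Longrightarrow> u < t \<Longrightarrow> has_law \<phi> (N t - N u) (free_poisson_law (t - u))"

definition compensated :: "(real \<Rightarrow> ('h::complex_hilbert \<Rightarrow>\<^sub>L 'h)) \<Rightarrow> real \<Rightarrow> ('h \<Rightarrow>\<^sub>L 'h)" where
  "compensated N t = N t - t *\<^sub>R id_blinfun"


section \<open>Kernels and contractions\<close>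

text \<open>A point \<open>(t\<^sub>1, \<dots>, t\<^sub>n)\<close> is the function \<open>x\<close> on \<open>{..<n}\<close> with \<open>x i = t\<^sub>i\<^sub>+\<^sub>1\<close>, extended by
  \<open>undefined\<close>. For \<open>n = 0\<close> the space is a single point of mass one. The \<open>L\<^sup>2\<close> functions are
  represented by Borel functions, not by classes modulo null sets.\<close>

type_synonym kernel = "(nat \<Rightarrow> real) \<Rightarrow> complex"

definition half_line :: "real measure" where
  "half_line = restrict_space lborel {0..}"

definition half_line_pow :: "nat \<Rightarrow> (nat \<Rightarrow> real) measure" where
  "half_line_pow n = (\<Pi>\<^sub>M i\<in>{..<n}. half_line)"

definition L2_kernels :: "nat \<Rightarrow> kernel set" where
  "L2_kernels n = {f \<in> borel_measurable (half_line_pow n).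
                     integrable (half_line_pow n) (\<lambda>x. (cmod (f x))\<^sup>2)}"

definition kernel_inner :: "nat \<Rightarrow> kernel \<Rightarrow> kernel \<Rightarrow> complex" where
  "kernel_inner n f g = (\<integral>x. f x * cnj (g x) \<partial>half_line_pow n)"

definition symmetric_kernel :: "nat \<Rightarrow> kernel \<Rightarrow> bool" where
  "symmetric_kernel n f \<longleftrightarrow>
     (AE x in half_line_pow n. f x \<in> \<real>) \<and>
     (\<forall>\<sigma>. \<sigma> permutes {..<n} \<longrightarrow> (AE x in half_line_pow n. f x = f (\<lambda>i. x (\<sigma> i))))"

definition kernel_adjoint :: "nat \<Rightarrow> kernel \<Rightarrow> kernel" where
  "kernel_adjoint n f x = cnj (f (\<lambda>i\<in>{..<n}. x (n - 1 - i)))"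

text \<open>\<open>arc_contraction n m p f g\<close> integrates out \<open>p\<close> variables;
  \<open>star_contraction n m p f g\<close> identifies \<open>p\<close> variables and integrates out \<open>p - 1\<close> of them.\<close>

definition arc_contraction :: "nat \<Rightarrow> nat \<Rightarrow> nat \<Rightarrow> kernel \<Rightarrow> kernel \<Rightarrow> kernel" where
  "arc_contraction n m p f g x =
     (\<integral>s. f (\<lambda>i\<in>{..<n}. if i < n - p then x i else s (i - (n - p))) *
           g (\<lambda>j\<in>{..<m}. if j < p then s (p - 1 - j) else x (n - p + (j - p)))
      \<partial>half_line_pow p)"

definition star_contraction :: "nat \<Rightarrow> nat \<Rightarrow> nat \<Rightarrow> kernel \<Rightarrow> kernel \<Rightarrow> kernel" where
  "star_contraction n m p f g x =
     (\<integral>s. f (\<lambda>i\<in>{..<n}. if i < n - p + 1 then x i else s (p - 2 - (i - (n - p + 1)))) *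
           g (\<lambda>j\<in>{..<m}. if j < p - 1 then s j else x (n - p + (j - (p - 1))))
      \<partial>half_line_pow (p - 1))"


section \<open>Free Poisson multiple integrals\<close>

text \<open>The first four conditions determine \<open>I\<close>; the case \<open>n = 0\<close> of \<open>box\<close> with linearity says
  that the integral of a constant \<open>c\<close> is \<open>c\<close> times the unit. The conditions \<open>orthogonal\<close> and
  \<open>adjoint\<close> follow from these and the properties of \<open>N\<close>; they are recorded as part of the
  specification.\<close>

locale free_poisson_integral =
  fixes A :: "('h::complex_hilbert \<Rightarrow>\<^sub>L 'h) set"
    and \<iota> :: "('h \<Rightarrow>\<^sub>L 'h) \<Rightarrow> 'l::complex_hilbert"
    and N :: "real \<Rightarrow> ('h \<Rightarrow>\<^sub>L 'h)"
    and I :: "nat \<Rightarrow> kernel \<Rightarrow> 'l"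
  assumes add: "f \<in> L2_kernels n \<Longrightarrow> g \<in> L2_kernels n \<Longrightarrow>
      I n (\<lambda>x. f x + g x) = I n f + I n g"
    and scaleC: "f \<in> L2_kernels n \<Longrightarrow> I n (\<lambda>x. c * f x) = c *\<^sub>C I n f"
    and box: "(\<And>i. i < n \<Longrightarrow> 0 \<le> a i \<and> a i \<le> b i) \<Longrightarrow>
      disjoint_family_on (\<lambda>i. {a i .. b i}) {..<n} \<Longrightarrow>
      I n (indicator (\<Pi>\<^sub>E i\<in>{..<n}. {a i .. b i})) =
        \<iota> (foldr (o\<^sub>L) (map (\<lambda>i. compensated N (b i) - compensated N (a i)) [0..<n]) id_blinfun)"
    and isometry: "f \<in> L2_kernels n \<Longrightarrow> g \<in> L2_kernels n \<Longrightarrow>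
      cinner (I n f) (I n g) = kernel_inner n f g"
    and orthogonal: "n \<noteq> m \<Longrightarrow> f \<in> L2_kernels n \<Longrightarrow> g \<in> L2_kernels m \<Longrightarrow>
      cinner (I n f) (I m g) = 0"
    and adjoint: "f \<in> L2_kernels n \<Longrightarrow> L2_star A \<iota> (I n f) = I n (kernel_adjoint n f)"

locale unital_star_algebra =
  fixes P :: "'a::{ab_group_add, scaleC} set"
    and mul :: "'a \<Rightarrow> 'a \<Rightarrow> 'a"
    and one :: 'a
    and star :: "'a \<Rightarrow> 'a"
  assumes one_closed: "one \<in> P"
    and add_closed: "X \<in> P \<Longrightarrow> Y \<in> P \<Longrightarrow> X + Y \<in> P"
    and scaleC_closed: "X \<in> P \<Longrightarrow> c *\<^sub>C X \<in> P"
    and mul_closed: "X \<in> P \<Longrightarrow> Y \<in> P \<Longrightarrow> mul X Y \<in> P"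
    and star_closed: "X \<in> P \<Longrightarrow> star X \<in> P"
    and mul_add_left: "X \<in> P \<Longrightarrow> Y \<in> P \<Longrightarrow> Z \<in> P \<Longrightarrow> mul (X + Y) Z = mul X Z + mul Y Z"
    and mul_add_right: "X \<in> P \<Longrightarrow> Y \<in> P \<Longrightarrow> Z \<in> P \<Longrightarrow> mul X (Y + Z) = mul X Y + mul X Z"
    and mul_scaleC_left: "X \<in> P \<Longrightarrow> Y \<in> P \<Longrightarrow> mul (c *\<^sub>C X) Y = c *\<^sub>C mul X Y"
    and mul_scaleC_right: "X \<in> P \<Longrightarrow> Y \<in> P \<Longrightarrow> mul X (c *\<^sub>C Y) = c *\<^sub>C mul X Y"
    and mul_assoc: "X \<in> P \<Longrightarrow> Y \<in> P \<Longrightarrow> Z \<in> P \<Longrightarrow> mul (mul X Y) Z = mul X (mul Y Z)"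
    and mul_one_left: "X \<in> P \<Longrightarrow> mul one X = X"
    and mul_one_right: "X \<in> P \<Longrightarrow> mul X one = X"
    and star_star: "X \<in> P \<Longrightarrow> star (star X) = X"
    and star_add: "X \<in> P \<Longrightarrow> Y \<in> P \<Longrightarrow> star (X + Y) = star X + star Y"
    and star_scaleC: "X \<in> P \<Longrightarrow> star (c *\<^sub>C X) = cnj c *\<^sub>C star X"
    and star_mul: "X \<in> P \<Longrightarrow> Y \<in> P \<Longrightarrow> star (mul X Y) = mul (star Y) (star X)"

text \<open>A unital *-algebra of multiple integrals inside \<open>L\<^sup>2(A, \<phi>)\<close>, in which products are
  computed by the product formula. Since the star contractions of square-integrable kernels
  need not be square-integrable, not all integrals can belong to such an algebra; \<open>P\<close> is any
  algebra spanned by the integrals it contains. By \<open>spanned\<close> and \<open>product_formula\<close>, the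
  multiplication is uniquely determined on \<open>P\<close>.\<close>

locale free_poisson_algebra = unital_star_algebra P mul "\<iota> id_blinfun" "L2_star A \<iota>"
  for A :: "('h::complex_hilbert \<Rightarrow>\<^sub>L 'h) set"
    and \<iota> :: "('h \<Rightarrow>\<^sub>L 'h) \<Rightarrow> 'l::complex_hilbert"
    and I :: "nat \<Rightarrow> kernel \<Rightarrow> 'l"
    and P :: "'l set"
    and mul :: "'l \<Rightarrow> 'l \<Rightarrow> 'l" +
  assumes spanned: "Z \<in> P \<Longrightarrow>
      \<exists>d h. (\<forall>k\<le>d. h k \<in> L2_kernels k \<and> I k (h k) \<in> P) \<and> Z = (\<Sum>k\<le>d. I k (h k))"
    and extends_product: "S \<in> A \<Longrightarrow> T \<in> A \<Longrightarrow> \<iota> S \<in> P \<Longrightarrow> \<iota> T \<in> P \<Longrightarrow>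
      mul (\<iota> S) (\<iota> T) = \<iota> (S o\<^sub>L T)"
    and star_contraction_L2: "f \<in> L2_kernels n \<Longrightarrow> g \<in> L2_kernels m \<Longrightarrow>
      I n f \<in> P \<Longrightarrow> I m g \<in> P \<Longrightarrow> 1 \<le> p \<Longrightarrow> p \<le> min n m \<Longrightarrow>
      star_contraction n m p f g \<in> L2_kernels (n + m - 2 * p + 1)"
    and product_formula: "f \<in> L2_kernels n \<Longrightarrow> g \<in> L2_kernels m \<Longrightarrow>
      I n f \<in> P \<Longrightarrow> I m g \<in> P \<Longrightarrow>
      mul (I n f) (I m g) =
        (\<Sum>p=0..min n m. I (n + m - 2 * p) (arc_contraction n m p f g)) +
        (\<Sum>p=1..min n m. I (n + m - 2 * p + 1) (star_contraction n m p f g))"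


section \<open>Classical Poisson multiple integrals\<close>

locale poisson_random_measure = prob_space M
  for M :: "'w measure" and \<eta> :: "'w \<Rightarrow> real measure" +
  assumes sets_random: "w \<in> space M \<Longrightarrow> sets (\<eta> w) = sets half_line"
    and measurable_random: "B \<in> sets half_line \<Longrightarrow>
      (\<lambda>w. emeasure (\<eta> w) B) \<in> borel_measurable M"
    and poisson: "B \<in> sets half_line \<Longrightarrow> emeasure half_line B < \<infinity> \<Longrightarrow>
      prob {w \<in> space M. emeasure (\<eta> w) B = of_nat k} =
        measure half_line B ^ k / fact k * exp (- measure half_line B)"
    and independent: "finite K \<Longrightarrow> (\<And>i. i \<in> K \<Longrightarrow> C i \<in> sets half_line) \<Longrightarrow>
      disjoint_family_on C K \<Longrightarrow>
      indep_vars (\<lambda>_ :: nat. borel) (\<lambda>i w. emeasure (\<eta> w) (C i)) K"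

definition compensated_measure :: "('w \<Rightarrow> real measure) \<Rightarrow> real set \<Rightarrow> 'w \<Rightarrow> real" where
  "compensated_measure \<eta> B w = measure (\<eta> w) B - measure half_line B"

definition symmetrization :: "nat \<Rightarrow> kernel \<Rightarrow> kernel" where
  "symmetrization n f x = (\<Sum>\<sigma> | \<sigma> permutes {..<n}. f (\<lambda>i. x (\<sigma> i))) / fact n"

text \<open>The Wiener--Ito integral, extended complex-linearly to complex kernels: it is the linear
  map with the usual value on products of pairwise disjoint sets and the usual isometry.
  Random variables are determined almost surely.\<close>

locale poisson_multiple_integral =
  fixes M :: "'w measure" and \<eta> :: "'w \<Rightarrow> real measure" and J :: "nat \<Rightarrow> kernel \<Rightarrow> 'w \<Rightarrow> complex"
  assumes measurable: "f \<in> L2_kernels n \<Longrightarrow> J n f \<in> borel_measurable M"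
    and square_integrable: "f \<in> L2_kernels n \<Longrightarrow> integrable M (\<lambda>w. (cmod (J n f w))\<^sup>2)"
    and add: "f \<in> L2_kernels n \<Longrightarrow> g \<in> L2_kernels n \<Longrightarrow>
      AE w in M. J n (\<lambda>x. f x + g x) w = J n f w + J n g w"
    and scale: "f \<in> L2_kernels n \<Longrightarrow> AE w in M. J n (\<lambda>x. c * f x) w = c * J n f w"
    and box: "(\<And>i. i < n \<Longrightarrow> B i \<in> sets half_line \<and> emeasure half_line (B i) < \<infinity>) \<Longrightarrow>
      disjoint_family_on B {..<n} \<Longrightarrow>
      AE w in M. J n (indicator (\<Pi>\<^sub>E i\<in>{..<n}. B i)) w =
        complex_of_real (\<Prod>i<n. compensated_measure \<eta> (B i) w)"
    and isometry: "f \<in> L2_kernels n \<Longrightarrow> g \<in> L2_kernels n \<Longrightarrow>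
      (\<integral>w. J n f w * cnj (J n g w) \<partial>M) =
        fact n * kernel_inner n (symmetrization n f) (symmetrization n g)"

text \<open>Existence of the moments: the joint moment is required to exist, and to factorise,
  whenever both individual moments exist.\<close>

definition moment_independent ::
  "'w measure \<Rightarrow> ('w \<Rightarrow> complex) \<Rightarrow> ('w \<Rightarrow> complex) \<Rightarrow> bool" where
  "moment_independent M X Y \<longleftrightarrow>
     (\<forall>a b :: nat. integrable M (\<lambda>w. X w ^ a) \<longrightarrow> integrable M (\<lambda>w. Y w ^ b) \<longrightarrow>
        integrable M (\<lambda>w. X w ^ a * Y w ^ b) \<and>
        (\<integral>w. X w ^ a * Y w ^ b \<partial>M) = (\<integral>w. X w ^ a \<partial>M) * (\<integral>w. Y w ^ b \<partial>M))"

end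

theory Submission
  imports Defs
begin

text \<open>Freeness forces the two kernels to live on disjoint parts of the half line, and a Poisson random
  measure is independent over disjoint sets.

  Write \<open>X = I\<^sub>n(f)\<close> and \<open>Y = I\<^sub>m(g)\<close>; both are centred and self-adjoint. The alternating word
  \<open>X (Y\<^sup>2 - \<phi>(Y\<^sup>2)) X\<close> has trace zero, that is \<open>\<parallel>XY\<parallel>\<^sup>2 = \<parallel>X\<parallel>\<^sup>2 \<parallel>Y\<parallel>\<^sup>2\<close> (\<open>free_norm_mul\<close>). In the product
  formula for \<open>XY\<close> all terms have different orders, so they are orthogonal; the leading one is the
  integral of \<open>f \<otimes> g\<close>, which alone has squared norm \<open>\<parallel>X\<parallel>\<^sup>2 \<parallel>Y\<parallel>\<^sup>2\<close>. All other terms therefore vanish,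
  in particular the first star contraction \<open>f(x, t) g(t, y)\<close>
  (\<open>star_contraction_eq_0_if_free\<close>).

  Let \<open>A\<close> be the set of those \<open>t\<close> for which \<open>\<integral> |g(t, y)|\<^sup>2 dy = 0\<close>. By Fubini and the symmetry of the
  kernels, \<open>f\<close> vanishes almost everywhere off \<open>A\<^sup>n\<close>, and \<open>g\<close> vanishes almost everywhere as soon as some
  coordinate lies in \<open>A\<close> (\<open>disjoint_supports\<close>).

  On the classical side, the multiple integral of a kernel supported by \<open>A\<^sup>n\<close> is almost surely equal to
  a function of the counts \<open>\<eta>(B)\<close> with \<open>B \<subseteq> A\<close> (\<open>determined_on_support\<close>): this is clear for boxes with
  pairwise disjoint sides, and it passes to linear combinations and to \<open>L\<^sup>2\<close> limits, which exhaust all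
  kernels because the diagonals are null sets (\<open>L2_kernels_induct\<close>). The counts of subsets of \<open>A\<close>
  and those of subsets of the complement generate independent sigma-algebras (\<open>local_sigma_indep\<close>). Hence
  the two classical integrals are independent, and their moments factorise.\<close>

section \<open>Product measures on powers of the half line\<close>

lemma sets_half_line [measurable_cong]: "sets half_line = sets (restrict_space borel {0..})"
  unfolding half_line_def by (simp add: sets_restrict_space)

lemma space_half_line [simp]: "space half_line = {0..}"
  unfolding half_line_def by (simp add: space_restrict_space)

lemma sigma_finite_half_line: "sigma_finite_measure half_line"
  unfolding half_line_def
  by (rule sigma_finite_measure_restrict_space) (auto intro: sigma_finite_lborel)

lemma emeasure_half_line: "B \<in> sets half_line \<Longrightarrow> emeasure half_line B = emeasure lborel B"
  unfolding half_line_def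
  by (subst emeasure_restrict_space) (auto simp: sets_restrict_space)

lemma sets_half_lineI: "B \<in> sets borel \<Longrightarrow> B \<subseteq> {0..} \<Longrightarrow> B \<in> sets half_line"
  by (auto simp: sets_half_line sets_restrict_space)

interpretation half_line: product_sigma_finite "\<lambda>_ :: nat. half_line"
  by (simp add: product_sigma_finite_def sigma_finite_half_line)

lemma sets_half_line_pow [measurable_cong]:
  "sets (half_line_pow n) = sets (\<Pi>\<^sub>M i\<in>{..<n}. half_line)"
  by (simp add: half_line_pow_def)

lemma space_half_line_pow: "space (half_line_pow n) = ({..<n} \<rightarrow>\<^sub>E {0..})"
  by (simp add: half_line_pow_def space_PiM)

lemma sigma_finite_half_line_pow: "sigma_finite_measure (half_line_pow n)"
  unfolding half_line_pow_def by (rule half_line.sigma_finite) simp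

lemma emeasure_half_line_pow_box:
  "(\<And>i. i < n \<Longrightarrow> A i \<in> sets half_line) \<Longrightarrow>
    emeasure (half_line_pow n) (\<Pi>\<^sub>E i\<in>{..<n}. A i) = (\<Prod>i<n. emeasure half_line (A i))"
  unfolding half_line_pow_def by (rule half_line.emeasure_PiM) auto

lemma sets_half_line_pow_box:
  "(\<And>i. i < n \<Longrightarrow> A i \<in> sets half_line) \<Longrightarrow> (\<Pi>\<^sub>E i\<in>{..<n}. A i) \<in> sets (half_line_pow n)"
  unfolding half_line_pow_def by (rule sets_PiM_I_finite) auto

text \<open>Points are extensional functions, so the values outside of the index range have to be reset to
  \<open>undefined\<close>; this is the role of the restriction here and in \<open>reindex\<close>.\<close>
definition join :: "nat \<Rightarrow> nat \<Rightarrow> (nat \<Rightarrow> real) \<Rightarrow> (nat \<Rightarrow> real) \<Rightarrow> (nat \<Rightarrow> real)" where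
  "join a b x y = (\<lambda>i\<in>{..<a + b}. if i < a then x i else y (i - a))"

definition reindex :: "nat \<Rightarrow> (nat \<Rightarrow> nat) \<Rightarrow> (nat \<Rightarrow> real) \<Rightarrow> (nat \<Rightarrow> real)" where
  "reindex n e x = (\<lambda>i\<in>{..<n}. x (e i))"

lemma measurable_reindex:
  assumes "\<And>i. i < n \<Longrightarrow> e i < m"
  shows "reindex n e \<in> measurable (half_line_pow m) (half_line_pow n)"
  unfolding half_line_pow_def reindex_def
  by (rule measurable_restrict) (auto intro!: measurable_component_singleton assms)

lemma measurable_join:
  "(\<lambda>(x, y). join a b x y) \<in>
     measurable (half_line_pow a \<Otimes>\<^sub>M half_line_pow b) (half_line_pow (a + b))"
  unfolding half_line_pow_def join_def case_prod_unfold
proof (rule measurable_restrict)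
  fix i assume "i \<in> {..<a + b}"
  then show "(\<lambda>z. if i < a then fst z i else snd z (i - a)) \<in>
      measurable (Pi\<^sub>M {..<a} (\<lambda>i. half_line) \<Otimes>\<^sub>M Pi\<^sub>M {..<b} (\<lambda>i. half_line)) half_line"
    by (cases "i < a") (auto intro!: measurable_compose[OF measurable_fst measurable_component_singleton]
        measurable_compose[OF measurable_snd measurable_component_singleton])
qed

lemma distr_reindex:
  assumes "bij_betw e {..<n} {..<n}"
  shows "distr (half_line_pow n) (half_line_pow n) (reindex n e) = half_line_pow n" (is "?D = _")
proof -
  have e: "e i < n" if "i < n" for i
    using assms that by (auto simp: bij_betw_def)
  note [measurable] = measurable_reindex[OF e]
  have "?D = PiM {..<n} (\<lambda>_. half_line)"
  proof (rule half_line.PiM_eqI)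
    fix A :: "nat \<Rightarrow> real set"
    assume A: "\<And>i. i \<in> {..<n} \<Longrightarrow> A i \<in> sets half_line"
    define e' where "e' = the_inv_into {..<n} e"
    have e': "e' i < n" "e (e' i) = i" if "i < n" for i
      using assms that unfolding e'_def
      by (metis bij_betw_def f_the_inv_into_f lessThan_iff order_refl the_inv_into_into)
         (metis assms bij_betw_def f_the_inv_into_f lessThan_iff that)
    have e'e: "e' (e i) = i" if "i < n" for i
      using assms that unfolding e'_def by (auto simp: bij_betw_def the_inv_into_f_f)
    have bij': "bij_betw e' {..<n} {..<n}"
      unfolding e'_def by (rule bij_betw_the_inv_into[OF assms])
    have "reindex n e -` (\<Pi>\<^sub>E i\<in>{..<n}. A i) \<inter> space (half_line_pow n) = (\<Pi>\<^sub>E i\<in>{..<n}. A (e' i))"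
    proof (intro set_eqI iffI)
      fix x assume "x \<in> reindex n e -` (\<Pi>\<^sub>E i\<in>{..<n}. A i) \<inter> space (half_line_pow n)"
      then have x: "x \<in> {..<n} \<rightarrow>\<^sub>E {0..}" and "\<And>i. i < n \<Longrightarrow> x (e i) \<in> A i"
        by (auto simp: space_half_line_pow reindex_def PiE_iff)
      then have "x i \<in> A (e' i)" if "i < n" for i
        using e'[OF that] by metis
      with x show "x \<in> (\<Pi>\<^sub>E i\<in>{..<n}. A (e' i))" by (auto simp: PiE_iff)
    next
      fix x assume x: "x \<in> (\<Pi>\<^sub>E i\<in>{..<n}. A (e' i))"
      then have "x (e i) \<in> A i" if "i < n" for i
        using e[OF that] e'e[OF that] by (metis PiE_mem lessThan_iff)
      moreover have "x i \<in> {0..}" if "i < n" for i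
        using x sets.sets_into_space[OF A[of "e' i"]] e'(1)[OF that] that by (auto simp: PiE_iff)
      ultimately show "x \<in> reindex n e -` (\<Pi>\<^sub>E i\<in>{..<n}. A i) \<inter> space (half_line_pow n)"
        using x by (auto simp: space_half_line_pow reindex_def PiE_iff)
    qed
    moreover have "(\<Pi>\<^sub>E i\<in>{..<n}. A i) \<in> sets (half_line_pow n)"
      using A by (auto intro: sets_half_line_pow_box)
    ultimately have "emeasure ?D (\<Pi>\<^sub>E i\<in>{..<n}. A i) = (\<Prod>i<n. emeasure half_line (A (e' i)))"
      using A e' by (simp add: emeasure_distr emeasure_half_line_pow_box)
    also have "\<dots> = (\<Prod>i<n. emeasure half_line (A i))"
      by (rule prod.reindex_bij_betw[OF bij'])
    finally show "emeasure ?D (\<Pi>\<^sub>E i\<in>{..<n}. A i) = (\<Prod>i\<in>{..<n}. emeasure half_line (A i))" .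
  qed (simp_all add: sets_half_line_pow)
  then show ?thesis by (simp add: half_line_pow_def)
qed

text \<open>All iterated integrals over blocks of variables are reduced to this form of Fubini's theorem and
  to the invariance under permutations above: the contractions integrate over blocks of variables which
  are shifted or reversed.\<close>
lemma distr_join:
  "distr (half_line_pow a \<Otimes>\<^sub>M half_line_pow b) (half_line_pow (a + b)) (\<lambda>(x, y). join a b x y) =
     half_line_pow (a + b)" (is "?D = _")
proof -
  interpret b: sigma_finite_measure "half_line_pow b" by (rule sigma_finite_half_line_pow)
  note [measurable] = measurable_join
  have "?D = PiM {..<a + b} (\<lambda>_. half_line)"
  proof (rule half_line.PiM_eqI)
    fix A :: "nat \<Rightarrow> real set"
    assume A: "\<And>i. i \<in> {..<a + b} \<Longrightarrow> A i \<in> sets half_line"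
    have A0: "x \<in> A i \<Longrightarrow> 0 \<le> x" if "i < a + b" for i x
      using sets.sets_into_space[OF A[of i]] that by auto
    have "(\<lambda>(x, y). join a b x y) -` (\<Pi>\<^sub>E i\<in>{..<a + b}. A i) \<inter>
        space (half_line_pow a \<Otimes>\<^sub>M half_line_pow b) =
        (\<Pi>\<^sub>E i\<in>{..<a}. A i) \<times> (\<Pi>\<^sub>E i\<in>{..<b}. A (a + i))"
    proof (rule set_eqI, unfold split_paired_all, rule iffI)
      fix x y assume "(x, y) \<in> (\<lambda>(x, y). join a b x y) -` (\<Pi>\<^sub>E i\<in>{..<a + b}. A i) \<inter>
        space (half_line_pow a \<Otimes>\<^sub>M half_line_pow b)"
      then have *: "join a b x y \<in> (\<Pi>\<^sub>E i\<in>{..<a + b}. A i)"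
        and **: "x \<in> {..<a} \<rightarrow>\<^sub>E {0..}" "y \<in> {..<b} \<rightarrow>\<^sub>E {0..}"
        by (auto simp: space_pair_measure space_half_line_pow)
      have "x i \<in> A i" if "i < a" for i
        using PiE_mem[OF *, of i] that by (auto simp: join_def)
      moreover have "y i \<in> A (a + i)" if "i < b" for i
        using PiE_mem[OF *, of "a + i"] that by (auto simp: join_def)
      ultimately show "(x, y) \<in> (\<Pi>\<^sub>E i\<in>{..<a}. A i) \<times> (\<Pi>\<^sub>E i\<in>{..<b}. A (a + i))"
        using ** by (auto simp: PiE_iff)
    next
      fix x y assume "(x, y) \<in> (\<Pi>\<^sub>E i\<in>{..<a}. A i) \<times> (\<Pi>\<^sub>E i\<in>{..<b}. A (a + i))"
      then have *: "x \<in> (\<Pi>\<^sub>E i\<in>{..<a}. A i)" "y \<in> (\<Pi>\<^sub>E i\<in>{..<b}. A (a + i))" by auto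
      have jA: "join a b x y i \<in> A i" if "i < a + b" for i
        using PiE_mem[OF *(1), of i] PiE_mem[OF *(2), of "i - a"] that by (auto simp: join_def)
      show "(x, y) \<in> (\<lambda>(x, y). join a b x y) -` (\<Pi>\<^sub>E i\<in>{..<a + b}. A i) \<inter>
          space (half_line_pow a \<Otimes>\<^sub>M half_line_pow b)"
      proof -
        have "0 \<le> x i" if "i < a" for i
          using A0[of i "x i"] PiE_mem[OF *(1), of i] that by auto
        moreover have "0 \<le> y i" if "i < b" for i
          using A0[of "a + i" "y i"] PiE_mem[OF *(2), of i] that by auto
        ultimately show ?thesis
          using jA * by (auto simp: PiE_iff space_pair_measure space_half_line_pow)
             (simp add: join_def)
      qed
    qed
    moreover have "(\<Pi>\<^sub>E i\<in>{..<a + b}. A i) \<in> sets (half_line_pow (a + b))"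
      using A by (auto intro: sets_half_line_pow_box)
    ultimately have "emeasure ?D (\<Pi>\<^sub>E i\<in>{..<a + b}. A i) =
        (\<Prod>i<a. emeasure half_line (A i)) * (\<Prod>i<b. emeasure half_line (A (a + i)))"
      using A by (simp add: emeasure_distr b.emeasure_pair_measure_Times sets_half_line_pow_box
          emeasure_half_line_pow_box)
    also have "\<dots> = (\<Prod>i\<in>{..<a + b}. emeasure half_line (A i))"
      by (induction b) (simp_all add: mult.assoc[symmetric])
    finally show "emeasure ?D (\<Pi>\<^sub>E i\<in>{..<a + b}. A i) = (\<Prod>i\<in>{..<a + b}. emeasure half_line (A i))" .
  qed (simp_all add: sets_half_line_pow)
  then show ?thesis by (simp add: half_line_pow_def)
qed

lemma nn_integral_reindex:
  assumes "bij_betw e {..<n} {..<n}" and h: "h \<in> borel_measurable (half_line_pow n)"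
  shows "(\<integral>\<^sup>+x. h (reindex n e x) \<partial>half_line_pow n) = (\<integral>\<^sup>+x. h x \<partial>half_line_pow n)"
proof -
  have "e i < n" if "i < n" for i
    using assms that by (auto simp: bij_betw_def)
  then show ?thesis
    by (subst (2) distr_reindex[OF assms(1), symmetric])
       (simp add: nn_integral_distr[OF measurable_reindex] h)
qed

lemma nn_integral_join:
  assumes h: "h \<in> borel_measurable (half_line_pow (a + b))"
  shows "(\<integral>\<^sup>+x. h x \<partial>half_line_pow (a + b)) =
    (\<integral>\<^sup>+x. (\<integral>\<^sup>+y. h (join a b x y) \<partial>half_line_pow b) \<partial>half_line_pow a)"
proof -
  interpret b: sigma_finite_measure "half_line_pow b" by (rule sigma_finite_half_line_pow)
  note [measurable] = measurable_join h
  have "(\<integral>\<^sup>+x. h x \<partial>half_line_pow (a + b)) =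
      (\<integral>\<^sup>+z. h (case z of (x, y) \<Rightarrow> join a b x y) \<partial>(half_line_pow a \<Otimes>\<^sub>M half_line_pow b))"
    by (subst distr_join[symmetric]) (rule nn_integral_distr[OF measurable_join], simp add: h)
  also have "\<dots> = (\<integral>\<^sup>+x. (\<integral>\<^sup>+y. h (join a b x y) \<partial>half_line_pow b) \<partial>half_line_pow a)"
    by (subst b.nn_integral_fst[symmetric]) simp_all
  finally show ?thesis .
qed

lemma nn_integral_join_mult:
  assumes h: "F \<in> borel_measurable (half_line_pow a)" "G \<in> borel_measurable (half_line_pow b)"
  shows "(\<integral>\<^sup>+z. F (reindex a (\<lambda>i. i) z) * G (reindex b (\<lambda>i. a + i) z) \<partial>half_line_pow (a + b)) =
    (\<integral>\<^sup>+x. F x \<partial>half_line_pow a) * (\<integral>\<^sup>+y. G y \<partial>half_line_pow b)"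
proof -
  have [measurable]: "reindex a (\<lambda>i. i) \<in> measurable (half_line_pow (a + b)) (half_line_pow a)"
    "reindex b (\<lambda>i. a + i) \<in> measurable (half_line_pow (a + b)) (half_line_pow b)"
    by (auto intro: measurable_reindex)
  note [measurable] = h
  have [simp]: "reindex a (\<lambda>i. i) (join a b x y) = x" if "x \<in> space (half_line_pow a)" for x y
    using that by (auto simp: reindex_def join_def space_half_line_pow PiE_iff extensional_def fun_eq_iff)
  have [simp]: "reindex b (\<lambda>i. a + i) (join a b x y) = y" if "y \<in> space (half_line_pow b)" for x y
    using that by (auto simp: reindex_def join_def space_half_line_pow PiE_iff extensional_def fun_eq_iff)
  have "(\<integral>\<^sup>+z. F (reindex a (\<lambda>i. i) z) * G (reindex b (\<lambda>i. a + i) z) \<partial>half_line_pow (a + b)) =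
    (\<integral>\<^sup>+x. (\<integral>\<^sup>+y. F x * G y \<partial>half_line_pow b) \<partial>half_line_pow a)"
    by (subst nn_integral_join) (auto intro!: nn_integral_cong)
  also have "\<dots> = (\<integral>\<^sup>+x. F x \<partial>half_line_pow a) * (\<integral>\<^sup>+y. G y \<partial>half_line_pow b)"
    by (simp add: nn_integral_cmult nn_integral_multc)
  finally show ?thesis .
qed

section \<open>Square-integrable kernels\<close>

text \<open>The squared \<open>L\<^sup>2\<close> norm takes values in \<open>ennreal\<close>, so that square-integrability is its finiteness
  and estimates can be made before integrability is known.\<close>
definition sqnorm :: "nat \<Rightarrow> kernel \<Rightarrow> ennreal" where
  "sqnorm n f = (\<integral>\<^sup>+x. ennreal (cmod (f x)) ^ 2 \<partial>half_line_pow n)"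

lemma L2_kernels_iff:
  "f \<in> L2_kernels n \<longleftrightarrow> f \<in> borel_measurable (half_line_pow n) \<and> sqnorm n f < \<infinity>"
  by (auto simp: L2_kernels_def integrable_iff_bounded sqnorm_def ennreal_power)

lemma L2_kernels_measurable: "f \<in> L2_kernels n \<Longrightarrow> f \<in> borel_measurable (half_line_pow n)"
  by (simp add: L2_kernels_iff)

lemma L2_kernels_dominated:
  assumes f: "f \<in> L2_kernels n" and h: "h \<in> borel_measurable (half_line_pow n)"
    and le: "\<And>x. x \<in> space (half_line_pow n) \<Longrightarrow> cmod (h x) \<le> c * cmod (f x)"
  shows "h \<in> L2_kernels n"
proof -
  have "sqnorm n h \<le> (\<integral>\<^sup>+x. ennreal (\<bar>c\<bar> ^ 2) * ennreal (cmod (f x)) ^ 2 \<partial>half_line_pow n)"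
    unfolding sqnorm_def
  proof (rule nn_integral_mono)
    fix x assume "x \<in> space (half_line_pow n)"
    then have "cmod (h x) \<le> \<bar>c\<bar> * cmod (f x)"
      using le[of x] by (meson abs_ge_self mult_right_mono norm_ge_zero order_trans)
    then have "(cmod (h x))\<^sup>2 \<le> (\<bar>c\<bar> * cmod (f x))\<^sup>2" by (simp add: power_mono)
    then show "(ennreal (cmod (h x)))\<^sup>2 \<le> ennreal (\<bar>c\<bar>\<^sup>2) * (ennreal (cmod (f x)))\<^sup>2"
      by (simp add: ennreal_power power_mult_distrib flip: ennreal_mult)
  qed
  also have "\<dots> = ennreal (\<bar>c\<bar> ^ 2) * sqnorm n f"
    unfolding sqnorm_def using L2_kernels_measurable[OF f, measurable] by (subst nn_integral_cmult) auto
  also have "\<dots> < \<infinity>"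
    using f by (simp add: L2_kernels_iff ennreal_mult_less_top)
  finally show ?thesis using h by (simp add: L2_kernels_iff)
qed

lemma L2_kernels_scale: "f \<in> L2_kernels n \<Longrightarrow> (\<lambda>x. c * f x) \<in> L2_kernels n"
  by (rule L2_kernels_dominated[where c = "cmod c"])
     (auto simp: norm_mult dest: L2_kernels_measurable)

lemma L2_kernels_add:
  assumes "f \<in> L2_kernels n" "g \<in> L2_kernels n"
  shows "(\<lambda>x. f x + g x) \<in> L2_kernels n"
proof -
  note [measurable] = assms[THEN L2_kernels_measurable]
  have "sqnorm n (\<lambda>x. f x + g x) \<le>
      (\<integral>\<^sup>+x. 2 * ennreal (cmod (f x)) ^ 2 + 2 * ennreal (cmod (g x)) ^ 2 \<partial>half_line_pow n)"
    unfolding sqnorm_def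
  proof (rule nn_integral_mono)
    fix x
    have "(cmod (f x + g x))\<^sup>2 \<le> (cmod (f x) + cmod (g x))\<^sup>2"
      by (simp add: power_mono norm_triangle_ineq)
    also have "\<dots> \<le> 2 * (cmod (f x))\<^sup>2 + 2 * (cmod (g x))\<^sup>2"
      using sum_squares_bound[of "cmod (f x)" "cmod (g x)"] by (simp add: power2_sum)
    finally have "ennreal ((cmod (f x + g x))\<^sup>2) \<le> ennreal (2 * (cmod (f x))\<^sup>2 + 2 * (cmod (g x))\<^sup>2)"
      by (rule ennreal_leI)
    then show "(ennreal (cmod (f x + g x)))\<^sup>2 \<le> 2 * (ennreal (cmod (f x)))\<^sup>2 + 2 * (ennreal (cmod (g x)))\<^sup>2"
      by (simp add: ennreal_power ennreal_mult)
  qed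
  also have "\<dots> = 2 * sqnorm n f + 2 * sqnorm n g"
    unfolding sqnorm_def by (subst nn_integral_add) (auto simp: nn_integral_cmult)
  also have "\<dots> < \<infinity>"
    using assms by (simp add: L2_kernels_iff ennreal_mult_less_top)
  finally show ?thesis by (simp add: L2_kernels_iff)
qed

lemma L2_kernels_diff:
  "f \<in> L2_kernels n \<Longrightarrow> g \<in> L2_kernels n \<Longrightarrow> (\<lambda>x. f x + (-1) * g x) \<in> L2_kernels n"
  by (intro L2_kernels_add L2_kernels_scale)

lemma sqnorm_reindex:
  assumes "f \<in> borel_measurable (half_line_pow n)" "bij_betw e {..<n} {..<n}"
  shows "sqnorm n (\<lambda>x. f (reindex n e x)) = sqnorm n f"
  unfolding sqnorm_def
  using nn_integral_reindex[OF assms(2), of "\<lambda>x. ennreal (cmod (f x)) ^ 2"] assms(1) by simp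

lemma measurable_reindex_bij:
  "bij_betw e {..<n} {..<n} \<Longrightarrow> reindex n e \<in> measurable (half_line_pow n) (half_line_pow n)"
  by (rule measurable_reindex) (auto simp: bij_betw_def)

lemma L2_kernels_reindex:
  assumes "f \<in> L2_kernels n" "bij_betw e {..<n} {..<n}"
  shows "(\<lambda>x. f (reindex n e x)) \<in> L2_kernels n"
  using assms measurable_compose[OF measurable_reindex_bij[OF assms(2)] L2_kernels_measurable[OF assms(1)]]
  by (simp add: L2_kernels_iff sqnorm_reindex)

lemma AE_reindex:
  assumes "bij_betw e {..<n} {..<n}" "AE x in half_line_pow n. Q x"
  shows "AE x in half_line_pow n. Q (reindex n e x)"
proof -
  have "AE x in distr (half_line_pow n) (half_line_pow n) (reindex n e). Q x"
    by (subst distr_reindex[OF assms(1)]) (rule assms(2))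
  from AE_distrD[OF measurable_reindex_bij[OF assms(1)] this] show ?thesis .
qed

lemma bij_betw_reverse: "bij_betw (\<lambda>i. n - 1 - i) {..<n} {..<n :: nat}"
  by (rule bij_betwI[where g = "\<lambda>i. n - 1 - i"]) auto

lemma kernel_adjoint_eq: "kernel_adjoint n f = (\<lambda>x. cnj (f (reindex n (\<lambda>i. n - 1 - i) x)))"
  by (simp add: kernel_adjoint_def reindex_def fun_eq_iff)

lemma L2_kernels_adjoint:
  assumes "f \<in> L2_kernels n" shows "kernel_adjoint n f \<in> L2_kernels n"
proof -
  note L = L2_kernels_reindex[OF assms bij_betw_reverse]
  have "cnj \<in> borel_measurable borel"
    by (intro borel_measurable_continuous_onI continuous_intros)
  note M = measurable_compose[OF L2_kernels_measurable[OF L] this]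
  show ?thesis
    unfolding kernel_adjoint_eq
    by (rule L2_kernels_dominated[OF L M, where c = 1]) (simp only: complex_mod_cnj mult_1 order_refl)
qed

lemma kernel_inner_self: 
  assumes "f \<in> L2_kernels n"
  shows "kernel_inner n f f = complex_of_real (enn2real (sqnorm n f))"
proof -
  note [measurable] = L2_kernels_measurable[OF assms]
  have "kernel_inner n f f = (\<integral>x. complex_of_real ((cmod (f x))\<^sup>2) \<partial>half_line_pow n)"
    unfolding kernel_inner_def by (simp only: complex_norm_square)
  also have "\<dots> = complex_of_real (\<integral>x. (cmod (f x))\<^sup>2 \<partial>half_line_pow n)"
    by (rule integral_complex_of_real)
  also have "(\<integral>x. (cmod (f x))\<^sup>2 \<partial>half_line_pow n) = enn2real (sqnorm n f)"
    unfolding sqnorm_def by (subst integral_eq_nn_integral) (auto simp: ennreal_power)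
  finally show ?thesis .
qed

lemma sqnorm_eq_0_iff:
  "f \<in> borel_measurable (half_line_pow n) \<Longrightarrow> sqnorm n f = 0 \<longleftrightarrow> (AE x in half_line_pow n. f x = 0)"
  unfolding sqnorm_def by (subst nn_integral_0_iff_AE) auto

lemma space_half_line_pow_0: "space (half_line_pow 0) = {\<lambda>_. undefined}"
  by (simp add: space_half_line_pow)

lemma measurable_half_line_pow_0: "h \<in> borel_measurable (half_line_pow 0)"
proof (rule measurableI)
  fix S :: "'a set"
  have "{\<lambda>_. undefined} \<in> sets (half_line_pow 0)"
    using sets.top[of "half_line_pow 0"] by (simp add: space_half_line_pow_0)
  then show "h -` S \<inter> space (half_line_pow 0) \<in> sets (half_line_pow 0)"
    by (cases "h (\<lambda>_. undefined) \<in> S") (auto simp: space_half_line_pow_0 Int_insert_right)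
qed simp

lemma emeasure_half_line_pow_0: "emeasure (half_line_pow 0) {\<lambda>_. undefined} = 1"
  using emeasure_half_line_pow_box[of 0 "\<lambda>_. {}"] by simp

lemma nn_integral_half_line_pow_0: "(\<integral>\<^sup>+x. h x \<partial>half_line_pow 0) = h (\<lambda>_. undefined)"
proof -
  have "(\<integral>\<^sup>+x. h x \<partial>half_line_pow 0) = (\<integral>\<^sup>+x. h (\<lambda>_. undefined) \<partial>half_line_pow 0)"
    by (rule nn_integral_cong) (simp add: space_half_line_pow_0)
  then show ?thesis by (simp add: space_half_line_pow_0 emeasure_half_line_pow_0)
qed

lemma integral_half_line_pow_0:
  "(\<integral>x. h x \<partial>half_line_pow 0) = (h (\<lambda>_. undefined) :: complex)"
proof -
  have "(\<integral>x. h x \<partial>half_line_pow 0) = (\<integral>x. h (\<lambda>_. undefined) \<partial>half_line_pow 0)"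
    by (rule Bochner_Integration.integral_cong) (simp_all add: space_half_line_pow_0)
  then show ?thesis
    by (simp add: space_half_line_pow_0 emeasure_half_line_pow_0 measure_def)
qed

lemma L2_kernels_0: "h \<in> L2_kernels 0"
  by (simp add: L2_kernels_iff measurable_half_line_pow_0 sqnorm_def nn_integral_half_line_pow_0
      ennreal_power)

section \<open>Contractions\<close>

lemma arc_contraction_eq:
  assumes "p \<le> n" "p \<le> m"
  shows "arc_contraction n m p f g x =
     (\<integral>s. f (join (n - p) p x s) *
          g (join p (m - p) (reindex p (\<lambda>i. p - 1 - i) s) (reindex (m - p) (\<lambda>i. (n - p) + i) x))
      \<partial>half_line_pow p)"
  unfolding arc_contraction_def join_def reindex_def
  using assms by (intro Bochner_Integration.integral_cong refl arg_cong2[where f = "(*)"] arg_cong[where f = f]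
       arg_cong[where f = g]) (auto simp: fun_eq_iff)

text \<open>By the Cauchy--Schwarz inequality in the contracted variables, the squared modulus is bounded by
  the product of a function of the free variables of \<open>f\<close> and one of those of \<open>g\<close>; these integrate to
  the two squared norms. The integrals of different
  orders are orthogonal only for square-integrable kernels.\<close>
lemma arc_contraction_L2:
  assumes f: "f \<in> L2_kernels n" and g: "g \<in> L2_kernels m" and p: "p \<le> n" "p \<le> m"
  shows "arc_contraction n m p f g \<in> L2_kernels (n + m - 2 * p)"
proof -
  define a b where "a = n - p" and "b = m - p"
  have n: "n = a + p" and m: "m = p + b" and ab: "n + m - 2 * p = a + b"
    using p by (auto simp: a_def b_def)
  define r where "r = reindex p (\<lambda>i. p - 1 - i)"
  have [measurable]: "r \<in> measurable (half_line_pow p) (half_line_pow p)"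
    unfolding r_def by (rule measurable_reindex_bij[OF bij_betw_reverse])
  have [measurable]: "f \<in> borel_measurable (half_line_pow (a + p))"
    "g \<in> borel_measurable (half_line_pow (p + b))"
    using f g by (auto simp: n m dest: L2_kernels_measurable)
  have [measurable]: "reindex a (\<lambda>i. i) \<in> measurable (half_line_pow (a + b)) (half_line_pow a)"
    "reindex b (\<lambda>i. a + i) \<in> measurable (half_line_pow (a + b)) (half_line_pow b)"
    by (auto intro: measurable_reindex)
  note [measurable] = measurable_join
  have [measurable]: "(\<lambda>z. join a' b' (u z) (v z)) \<in> measurable N (half_line_pow (a' + b'))"
    if [measurable]: "u \<in> measurable N (half_line_pow a')" "v \<in> measurable N (half_line_pow b')"
    for N :: "'x measure" and u v a' b'
    using measurable_compose[OF measurable_Pair[OF that] measurable_join] by simp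
  interpret p: sigma_finite_measure "half_line_pow p" by (rule sigma_finite_half_line_pow)
  interpret b: sigma_finite_measure "half_line_pow b" by (rule sigma_finite_half_line_pow)
  interpret pb: pair_sigma_finite "half_line_pow p" "half_line_pow b" ..
  let ?x = "reindex a (\<lambda>i. i)" and ?y = "reindex b (\<lambda>i. a + i)"
  let ?h = "\<lambda>x s. f (join a p (?x x) s) * g (join p b (r s) (?y x))"
  have eq: "arc_contraction n m p f g = (\<lambda>x. \<integral>s. ?h x s \<partial>half_line_pow p)"
  proof
    fix x
    have "join a p x s = join a p (?x x) s" for s
      by (auto simp: join_def reindex_def fun_eq_iff)
    then show "arc_contraction n m p f g x = (\<integral>s. ?h x s \<partial>half_line_pow p)"
      unfolding arc_contraction_eq[OF p] r_def a_def b_def by simp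
  qed
  have meas: "arc_contraction n m p f g \<in> borel_measurable (half_line_pow (a + b))"
    unfolding eq by measurable
  define F where "F u = (\<integral>\<^sup>+s. ennreal (cmod (f (join a p u s))) ^ 2 \<partial>half_line_pow p)" for u
  define G where "G v = (\<integral>\<^sup>+s. ennreal (cmod (g (join p b (r s) v))) ^ 2 \<partial>half_line_pow p)" for v
  have F_meas [measurable]: "F \<in> borel_measurable (half_line_pow a)" unfolding F_def by measurable
  have G_meas [measurable]: "G \<in> borel_measurable (half_line_pow b)" unfolding G_def by measurable
  have "sqnorm (a + b) (arc_contraction n m p f g) \<le>
      (\<integral>\<^sup>+x. F (?x x) * G (?y x) \<partial>half_line_pow (a + b))"
    unfolding sqnorm_def
  proof (rule nn_integral_mono)
    fix x assume x: "x \<in> space (half_line_pow (a + b))"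
    have [measurable]: "?x x \<in> space (half_line_pow a)" "?y x \<in> space (half_line_pow b)"
      using x by (auto intro: measurable_space)
    have 1: "(\<lambda>s. f (join a p (?x x) s)) \<in> borel_measurable (half_line_pow p)"
      by measurable
    have 2: "(\<lambda>s. g (join p b (r s) (?y x))) \<in> borel_measurable (half_line_pow p)"
      by measurable
    have "ennreal (cmod (arc_contraction n m p f g x)) \<le> (\<integral>\<^sup>+s. ennreal (cmod (?h x s)) \<partial>half_line_pow p)"
      unfolding eq using integral_norm_bound_ennreal[of "half_line_pow p" "?h x"]
      by (cases "integrable (half_line_pow p) (?h x)") (auto simp: not_integrable_integral_eq)
    also have "\<dots> = (\<integral>\<^sup>+s. ennreal (cmod (f (join a p (?x x) s))) * ennreal (cmod (g (join p b (r s) (?y x)))) \<partial>half_line_pow p)"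
      by (simp add: norm_mult ennreal_mult)
    finally have "ennreal (cmod (arc_contraction n m p f g x)) ^ 2 \<le> \<dots> ^ 2"
      by (rule power_mono) simp
    also have "\<dots> \<le> F (?x x) * G (?y x)"
      unfolding F_def G_def using 1 2 by (intro Cauchy_Schwarz_nn_integral) auto
    finally show "(ennreal (cmod (arc_contraction n m p f g x)))\<^sup>2 \<le> F (?x x) * G (?y x)" .
  qed
  also have "\<dots> = (\<integral>\<^sup>+u. F u \<partial>half_line_pow a) * (\<integral>\<^sup>+v. G v \<partial>half_line_pow b)"
    by (rule nn_integral_join_mult) measurable
  also have "(\<integral>\<^sup>+u. F u \<partial>half_line_pow a) = sqnorm n f"
    unfolding F_def sqnorm_def n by (subst nn_integral_join) auto
  also have "(\<integral>\<^sup>+v. G v \<partial>half_line_pow b) =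
      (\<integral>\<^sup>+v. (\<integral>\<^sup>+s. ennreal (cmod (g (join p b s v))) ^ 2 \<partial>half_line_pow p) \<partial>half_line_pow b)"
  proof (rule nn_integral_cong)
    fix v assume [measurable]: "v \<in> space (half_line_pow b)"
    show "G v = (\<integral>\<^sup>+s. ennreal (cmod (g (join p b s v))) ^ 2 \<partial>half_line_pow p)"
      unfolding G_def r_def
      by (rule nn_integral_reindex[OF bij_betw_reverse, of "\<lambda>s. ennreal (cmod (g (join p b s v))) ^ 2"]) measurable
  qed
  also have "\<dots> = sqnorm m g"
    unfolding sqnorm_def m by (subst nn_integral_join, simp, subst pb.Fubini') simp_all
  also have "sqnorm n f * sqnorm m g < \<infinity>"
    using f g by (simp add: L2_kernels_iff ennreal_mult_less_top)
  finally show ?thesis using meas by (simp add: L2_kernels_iff ab)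
qed

lemma arc_contraction_0_eq:
  "arc_contraction n m 0 f g x = f (reindex n (\<lambda>i. i) x) * g (reindex m (\<lambda>i. n + i) x)"
  unfolding arc_contraction_def integral_half_line_pow_0 reindex_def
  by (intro arg_cong2[where f = "(*)"] arg_cong[where f = f] arg_cong[where f = g]) auto

text \<open>Contracting no variable gives the tensor product \<open>f \<otimes> g\<close>, whose norm is exactly the product of
  the norms; this is the value that freeness prescribes for the norm of the product of the integrals.\<close>
lemma sqnorm_arc_contraction_0:
  assumes "f \<in> L2_kernels n" "g \<in> L2_kernels m"
  shows "sqnorm (n + m) (arc_contraction n m 0 f g) = sqnorm n f * sqnorm m g"
proof -
  note [measurable] = assms[THEN L2_kernels_measurable]
  show ?thesis
    unfolding sqnorm_def arc_contraction_0_eq norm_mult ennreal_mult[OF norm_ge_zero norm_ge_zero] power_mult_distrib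
    by (subst nn_integral_join_mult[symmetric]) auto
qed

lemma star_contraction_1_eq:
  assumes "n \<ge> 1"
  shows "star_contraction n m 1 f g x = f (reindex n (\<lambda>i. i) x) * g (reindex m (\<lambda>i. n - 1 + i) x)"
  unfolding star_contraction_def diff_self_eq_0 integral_half_line_pow_0 reindex_def using assms
  by (intro arg_cong2[where f = "(*)"] arg_cong[where f = f] arg_cong[where f = g]) auto

text \<open>Contracting all variables gives the inner product of \<open>f\<close> with the adjoint of \<open>g\<close>.\<close>
lemma arc_contraction_full:
  "arc_contraction n n n f g x = (\<integral>s. f s * g (reindex n (\<lambda>i. n - 1 - i) s) \<partial>half_line_pow n)"
  unfolding arc_contraction_def reindex_def
  by (intro Bochner_Integration.integral_cong refl arg_cong2[where f = "(*)"] arg_cong[where f = f]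
       arg_cong[where f = g]) (auto simp: space_half_line_pow PiE_iff extensional_def fun_eq_iff)

section \<open>Complex Hilbert spaces\<close>

lemma cinner_add_right: "cinner z (x + y) = cinner z x + cinner z (y :: 'a::complex_hilbert)"
  by (metis cinner_add_left cinner_commute complex_cnj_add)

lemma cinner_scaleC_right: "cinner x (c *\<^sub>C y) = cnj c * cinner x (y :: 'a::complex_hilbert)"
  by (metis cinner_scaleC_left cinner_commute complex_cnj_mult)

lemma cinner_zero_left [simp]: "cinner 0 (x :: 'a::complex_hilbert) = 0"
  using cinner_add_left[of 0 0 x] by simp

lemma cinner_zero_right [simp]: "cinner (x :: 'a::complex_hilbert) 0 = 0"
  by (metis cinner_commute cinner_zero_left complex_cnj_zero)

lemma cinner_sum_left: "cinner (\<Sum>i\<in>K. x i) z = (\<Sum>i\<in>K. cinner (x i) (z :: 'a::complex_hilbert))"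
  by (induction K rule: infinite_finite_induct) (simp_all add: cinner_add_left)

lemma cinner_sum_right: "cinner z (\<Sum>i\<in>K. x i) = (\<Sum>i\<in>K. cinner z (x i :: 'a::complex_hilbert))"
  by (induction K rule: infinite_finite_induct) (simp_all add: cinner_add_right)

lemma scaleC_zero [simp]: "0 *\<^sub>C x = (0 :: 'a::complex_hilbert)"
  using scaleC_of_real[of 0 x] by simp

lemma scaleC_one [simp]: "1 *\<^sub>C x = (x :: 'a::complex_hilbert)"
  using scaleC_of_real[of 1 x] by simp

lemma scaleC_minus_one [simp]: "(-1) *\<^sub>C x = - (x :: 'a::complex_hilbert)"
  using scaleC_of_real[of "-1" x] by simp

lemma scaleC_minus_left: "(- c) *\<^sub>C x = - (c *\<^sub>C (x :: 'a::complex_hilbert))"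
  using scaleC_scaleC[of "-1" c x] by simp

lemma cinner_minus_left: "cinner (- x) y = - cinner x (y :: 'a::complex_hilbert)"
  using cinner_scaleC_left[of "-1" x y] by simp

lemma cinner_minus_right: "cinner x (- y) = - cinner x (y :: 'a::complex_hilbert)"
  using cinner_scaleC_right[of x "-1" y] by simp

lemma cinner_self_eq_0: "cinner x x = 0 \<longleftrightarrow> x = (0 :: 'a::complex_hilbert)"
  by (simp add: cinner_self)

text \<open>Then \<open>U\<close> is the orthogonal projection of \<open>Z\<close> to the line of \<open>U\<close>, and \<open>Z\<close> is not longer than its
  projection.\<close>
lemma eq_of_cinner_eq:
  fixes Z U :: "'a::complex_hilbert"
  assumes "cinner Z U = cinner U U" "cinner Z Z = cinner U U"
  shows "Z = U"
proof -
  have "cinner U Z = cinner U U"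
    using assms(1) by (metis cinner_commute)
  then have "cinner (Z + (- U)) (Z + (- U)) = 0"
    using assms by (simp only: cinner_add_left cinner_add_right cinner_minus_left cinner_minus_right) simp
  then show ?thesis by (simp add: cinner_self_eq_0)
qed

section \<open>Freeness and the vanishing of the star contraction\<close>

locale free_poisson_setting =
  integrals: free_poisson_integral A \<iota> N I + free_poisson_algebra A \<iota> I P mul
  for A :: "('h::complex_hilbert \<Rightarrow>\<^sub>L 'h) set" and \<iota> :: "('h \<Rightarrow>\<^sub>L 'h) \<Rightarrow> 'l::complex_hilbert"
    and N :: "real \<Rightarrow> ('h \<Rightarrow>\<^sub>L 'h)" and I :: "nat \<Rightarrow> kernel \<Rightarrow> 'l"
    and P :: "'l set" and mul :: "'l \<Rightarrow> 'l \<Rightarrow> 'l"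
begin

abbreviation unit :: 'l where "unit \<equiv> \<iota> id_blinfun"
abbreviation star :: "'l \<Rightarrow> 'l" where "star \<equiv> L2_star A \<iota>"
abbreviation trace :: "'l \<Rightarrow> complex" where "trace \<equiv> L2_trace \<iota>"

lemma trace_eq: "trace Z = cinner Z unit"
  by (simp add: L2_trace_def)

text \<open>The kernels are functions and not classes modulo null sets; the isometry makes the integral blind
  to the difference.\<close>
lemma I_cong_AE:
  assumes "h \<in> L2_kernels n" "h' \<in> L2_kernels n" "AE x in half_line_pow n. h x = h' x"
  shows "I n h = I n h'"
proof -
  let ?d = "\<lambda>x. h x + (-1) * h' x"
  have d: "?d \<in> L2_kernels n" by (rule L2_kernels_diff[OF assms(1,2)])
  have "sqnorm n ?d = 0"
    using assms(3) L2_kernels_measurable[OF d] by (subst sqnorm_eq_0_iff) auto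
  then have "cinner (I n ?d) (I n ?d) = 0"
    by (simp only: integrals.isometry[OF d d] kernel_inner_self[OF d] enn2real_0 of_real_0)
  moreover have "I n ?d = I n h - I n h'"
    using integrals.add[OF assms(1) L2_kernels_scale[OF assms(2), of "-1"]]
      integrals.scaleC[OF assms(2), of "-1"] by (simp only: scaleC_minus_one diff_conv_add_uminus)
  ultimately show ?thesis by (simp add: cinner_self_eq_0)
qed

text \<open>The box with no sides is the single point of the space with no variables.\<close>
lemma unit_eq: "unit = I 0 (indicator (\<Pi>\<^sub>E i\<in>{..<0}. {0..0}))"
  using integrals.box[of 0 "\<lambda>_. 0" "\<lambda>_. 0"] by (simp add: disjoint_family_on_def)

lemma trace_I:
  assumes "h \<in> L2_kernels n"
  shows "trace (I n h) = (if n = 0 then h (\<lambda>_. undefined) else 0)"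
  unfolding trace_eq unit_eq using assms L2_kernels_0
  by (auto simp: integrals.orthogonal integrals.isometry kernel_inner_def integral_half_line_pow_0
      restrict_def)

text \<open>Only the integral of order \<open>0\<close> in the product formula has nonzero trace. It occurs when both orders
  agree and all variables are contracted.\<close>
lemma trace_mul_I:
  assumes h: "h \<in> L2_kernels k" "I k h \<in> P" and h': "h' \<in> L2_kernels l" "I l h' \<in> P"
  shows "trace (mul (I k h) (I l h')) = cinner (I k h) (star (I l h'))"
proof -
  have arc: "trace (I (k + l - 2 * p) (arc_contraction k l p h h')) =
      (if k = l \<and> p = k then arc_contraction k l k h h' (\<lambda>_. undefined) else 0)"
    if "p \<le> min k l" for p
    using that h(1) h'(1) by (subst trace_I) (auto intro: arc_contraction_L2)
  have star: "trace (I (k + l - 2 * p + 1) (star_contraction k l p h h')) = 0"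
    if "1 \<le> p" "p \<le> min k l" for p
    using that star_contraction_L2[OF h(1) h'(1) h(2) h'(2) that] by (subst trace_I) auto
  have "trace (mul (I k h) (I l h')) =
     (\<Sum>p=0..min k l. trace (I (k + l - 2 * p) (arc_contraction k l p h h'))) +
     (\<Sum>p=1..min k l. trace (I (k + l - 2 * p + 1) (star_contraction k l p h h')))"
    unfolding trace_eq product_formula[OF h(1) h'(1) h(2) h'(2)]
    by (simp add: cinner_add_left cinner_sum_left)
  also have "\<dots> = (\<Sum>p=0..min k l. if k = l \<and> p = k then arc_contraction k l k h h' (\<lambda>_. undefined) else 0)"
    using star by (subst (2) sum.neutral) (auto simp: arc)
  also have "\<dots> = (if k = l then arc_contraction k l k h h' (\<lambda>_. undefined) else 0)"
    by (cases "k = l") simp_all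
  also have "\<dots> = cinner (I k h) (I l (kernel_adjoint l h'))"
  proof (cases "k = l")
    case True
    show ?thesis
      unfolding True integrals.isometry[OF h(1)[unfolded True] L2_kernels_adjoint[OF h'(1)]]
      by (simp add: kernel_inner_def kernel_adjoint_eq arc_contraction_full)
  next
    case False
    then show ?thesis using h h' by (simp add: integrals.orthogonal L2_kernels_adjoint)
  qed
  finally show ?thesis using h' by (simp add: integrals.adjoint)
qed

lemma sum_closed: "(\<And>k. k \<le> d \<Longrightarrow> Z k \<in> P) \<Longrightarrow> (\<Sum>k\<le>(d::nat). Z k) \<in> P"
  by (induction d) (simp_all add: add_closed)

lemma star_sum: "(\<And>k. k \<le> d \<Longrightarrow> Z k \<in> P) \<Longrightarrow> star (\<Sum>k\<le>(d::nat). Z k) = (\<Sum>k\<le>d. star (Z k))"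
  by (induction d) (simp_all add: star_add sum_closed)

lemma mul_sum_left:
  "W \<in> P \<Longrightarrow> (\<And>k. k \<le> d \<Longrightarrow> Z k \<in> P) \<Longrightarrow> mul (\<Sum>k\<le>(d::nat). Z k) W = (\<Sum>k\<le>d. mul (Z k) W)"
  by (induction d) (simp_all add: mul_add_left sum_closed)

lemma mul_sum_right:
  "W \<in> P \<Longrightarrow> (\<And>k. k \<le> d \<Longrightarrow> Z k \<in> P) \<Longrightarrow> mul W (\<Sum>k\<le>(d::nat). Z k) = (\<Sum>k\<le>d. mul W (Z k))"
  by (induction d) (simp_all add: mul_add_right sum_closed)

text \<open>The multiplication on \<open>P\<close> is computed by the product formula, so the usual relation
  between the trace and the inner product is derived from the components.\<close>
lemma trace_mul:
  assumes "Z \<in> P" "W \<in> P"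
  shows "trace (mul Z W) = cinner Z (star W)"
proof -
  obtain d h where h: "\<And>k. k \<le> d \<Longrightarrow> h k \<in> L2_kernels k" "\<And>k. k \<le> d \<Longrightarrow> I k (h k) \<in> P"
    and Z: "Z = (\<Sum>k\<le>d. I k (h k))"
    using spanned[OF assms(1)] by blast
  obtain e h' where h': "\<And>k. k \<le> e \<Longrightarrow> h' k \<in> L2_kernels k" "\<And>k. k \<le> e \<Longrightarrow> I k (h' k) \<in> P"
    and W: "W = (\<Sum>k\<le>e. I k (h' k))"
    using spanned[OF assms(2)] by blast
  have "mul Z W = (\<Sum>k\<le>d. \<Sum>l\<le>e. mul (I k (h k)) (I l (h' l)))"
    using h h' assms(2) by (simp add: Z mul_sum_left) (simp add: W mul_sum_right)
  then have "trace (mul Z W) = (\<Sum>k\<le>d. \<Sum>l\<le>e. trace (mul (I k (h k)) (I l (h' l))))"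
    by (simp add: trace_eq cinner_sum_left)
  also have "\<dots> = (\<Sum>k\<le>d. \<Sum>l\<le>e. cinner (I k (h k)) (star (I l (h' l))))"
    using h h' by (simp add: trace_mul_I)
  also have "\<dots> = cinner Z (star W)"
    using h' by (simp add: Z W star_sum cinner_sum_left cinner_sum_right) (rule sum.swap)
  finally show ?thesis .
qed

text \<open>Freeness kills the trace of the alternating word \<open>X (Y\<^sup>2 - \<parallel>Y\<parallel>\<^sup>2) X\<close>, and the trace of
  \<open>X Y Y X = (X Y) (X Y)\<^sup>*\<close> is the squared norm of \<open>X Y\<close>. Choosing this word instead of \<open>X\<^sup>2 Y\<^sup>2\<close> avoids
  cyclic permutations under the trace.\<close>
lemma free_norm_mul:
  assumes X: "X \<in> P" "star X = X" "trace X = 0" and Y: "Y \<in> P" "star Y = Y"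
    and free: "free_elements mul unit trace (\<lambda>b::bool. if b then X else Y)"
  shows "cinner (mul X Y) (mul X Y) = cinner X X * cinner Y Y"
proof -
  have "poly_eval mul unit [:0, 1:] X = X"
    using X by (simp add: poly_eval_def mul_one_right)
  then have X': "X \<in> polynomials_in mul unit X"
    unfolding polynomials_in_def by (metis rangeI)
  have "{..2::nat} = {0, 1, 2}" by auto
  then have "poly_eval mul unit [:0, 0, 1:] Y = mul Y Y"
    using Y by (simp add: poly_eval_def mul_one_right numeral_2_eq_2)
  then have Y': "mul Y Y \<in> polynomials_in mul unit Y"
    unfolding polynomials_in_def by (metis rangeI)
  define c where "c = trace (mul Y Y)"
  have c: "c = cinner Y Y" using Y by (simp add: c_def trace_mul)
  have YY: "mul Y Y \<in> P" and YX: "mul Y X \<in> P" and XY: "mul X Y \<in> P" and XX: "mul X X \<in> P"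
    using X Y by (auto intro: mul_closed)
  note closed = X(1) Y(1) YY YX XY XX
  have free': "zs \<noteq> [] \<Longrightarrow> distinct_adj (map fst zs) \<Longrightarrow>
      \<forall>(i, z)\<in>set zs. z \<in> polynomials_in mul unit (if i then X else Y) \<Longrightarrow>
      trace (foldr mul (map (\<lambda>(i, z). z - trace z *\<^sub>C unit) zs) unit) = 0"
    for zs :: "(bool \<times> 'l) list"
    using free by (auto simp: free_elements_def free_family_def)
  \<comment> \<open>the alternating word; its last factor is multiplied by the unit\<close>
  have "trace (foldr mul (map (\<lambda>(i, z). z - trace z *\<^sub>C unit)
      [(True, X), (False, mul Y Y), (True, X)]) unit) = 0"
    by (rule free') (simp_all add: X' Y')
  then have "trace (mul X (mul (mul Y Y - c *\<^sub>C unit) X)) = 0"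
    using X by (simp add: mul_one_right c_def)
  moreover have "mul (mul Y Y - c *\<^sub>C unit) X = mul (mul Y Y) X + (- c) *\<^sub>C X"
  proof -
    have "mul (mul Y Y - c *\<^sub>C unit) X = mul (mul Y Y + (- c) *\<^sub>C unit) X"
      by (simp add: scaleC_minus_left)
    also have "\<dots> = mul (mul Y Y) X + mul ((- c) *\<^sub>C unit) X"
      using closed by (intro mul_add_left scaleC_closed one_closed)
    also have "mul ((- c) *\<^sub>C unit) X = (- c) *\<^sub>C X"
      using closed by (simp only: mul_scaleC_left one_closed mul_one_left)
    finally show ?thesis .
  qed
  moreover have "mul X (mul (mul Y Y) X + (- c) *\<^sub>C X) = mul (mul X Y) (mul Y X) + (- c) *\<^sub>C mul X X"
    using closed by (simp add: mul_add_right scaleC_closed mul_closed mul_scaleC_right mul_assoc)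
  ultimately have "trace (mul (mul X Y) (mul Y X)) = c * trace (mul X X)"
    by (simp add: trace_eq cinner_add_left cinner_scaleC_left)
  moreover have "star (mul Y X) = mul X Y"
    using X Y by (simp add: star_mul)
  ultimately show ?thesis using X XY YX by (simp add: trace_mul c mult.commute)
qed

text \<open>The arc contractions contribute the orders \<open>n + m\<close>, \<open>n + m - 2\<close>, ... and the star contractions
  \<open>n + m - 1\<close>, \<open>n + m - 3\<close>, ..., so every order occurs once and \<open>X Y\<close> has an orthogonal expansion.
  Its leading term already has the full norm of \<open>X Y\<close>.\<close>
lemma star_contraction_eq_0_if_free:
  assumes n: "n \<ge> 1" "f \<in> L2_kernels n" "I n f \<in> P" "star (I n f) = I n f"
    and m: "m \<ge> 1" "g \<in> L2_kernels m" "I m g \<in> P" "star (I m g) = I m g"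
    and free: "free_elements mul unit trace (\<lambda>b::bool. if b then I n f else I m g)"
  shows "AE x in half_line_pow (n + m - 1). star_contraction n m 1 f g x = 0"
proof -
  define Z where "Z = mul (I n f) (I m g)"
  define U where "U = I (n + m) (arc_contraction n m 0 f g)"
  define V where "V = I (n + m - 1) (star_contraction n m 1 f g)"
  have arc: "arc_contraction n m p f g \<in> L2_kernels (n + m - 2 * p)" if "p \<le> min n m" for p
    using n m that by (auto intro: arc_contraction_L2)
  have star: "star_contraction n m p f g \<in> L2_kernels (n + m - 2 * p + 1)"
    if "1 \<le> p" "p \<le> min n m" for p
    using n m that by (intro star_contraction_L2) auto
  have arc_0: "arc_contraction n m 0 f g \<in> L2_kernels (n + m)" using arc[of 0] by simp
  \<comment> \<open>the order \<open>n + m - 2 * 1 + 1\<close> is \<open>n + m - 1\<close>, since \<open>n, m \<ge> 1\<close>\<close>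
  have star_1: "star_contraction n m 1 f g \<in> L2_kernels (n + m - 1)"
    using star[of 1] n m by (simp add: numeral_2_eq_2 Suc_diff_Suc)
  have Z: "cinner Z W =
     (\<Sum>p=0..min n m. cinner (I (n + m - 2 * p) (arc_contraction n m p f g)) W) +
     (\<Sum>p=1..min n m. cinner (I (n + m - 2 * p + 1) (star_contraction n m p f g)) W)" for W
    unfolding Z_def using n m by (simp add: product_formula cinner_add_left cinner_sum_left)
  have "cinner Z U = (\<Sum>p=0..min n m. if p = 0 then cinner U U else 0) + (\<Sum>p=1..min n m. 0)"
    unfolding Z U_def
  proof (intro arg_cong2[where f = "(+)"] sum.cong refl)
    fix p assume p: "p \<in> {0..min n m}"
    show "cinner (I (n + m - 2 * p) (arc_contraction n m p f g)) (I (n + m) (arc_contraction n m 0 f g)) =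
      (if p = 0 then cinner (I (n + m) (arc_contraction n m 0 f g)) (I (n + m) (arc_contraction n m 0 f g)) else 0)"
      using p arc[of p] arc_0 by (auto intro!: integrals.orthogonal)
  next
    fix p assume p: "p \<in> {1..min n m}"
    show "cinner (I (n + m - 2 * p + 1) (star_contraction n m p f g)) (I (n + m) (arc_contraction n m 0 f g)) = 0"
      using p star[of p] arc_0 by (intro integrals.orthogonal) auto
  qed
  then have ZU: "cinner Z U = cinner U U" by simp
  have "cinner Z V = (\<Sum>p=0..min n m. 0) + (\<Sum>p=1..min n m. if p = 1 then cinner V V else 0)"
    unfolding Z V_def
  proof (intro arg_cong2[where f = "(+)"] sum.cong refl)
    fix p assume p: "p \<in> {0..min n m}"
    then have "n + m - 2 * p \<noteq> n + m - 1" using n m by presburger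
    then show "cinner (I (n + m - 2 * p) (arc_contraction n m p f g)) (I (n + m - 1) (star_contraction n m 1 f g)) = 0"
      using p arc[of p] star_1 by (intro integrals.orthogonal) auto
  next
    fix p assume p: "p \<in> {1..min n m}"
    then have "p \<noteq> 1 \<Longrightarrow> n + m - 2 * p + 1 \<noteq> n + m - 1"
      and "p = 1 \<Longrightarrow> n + m - 2 * p + 1 = n + m - 1"
      by (auto simp: min_def split: if_splits)
    then show "cinner (I (n + m - 2 * p + 1) (star_contraction n m p f g)) (I (n + m - 1) (star_contraction n m 1 f g)) =
      (if p = 1 then cinner (I (n + m - 1) (star_contraction n m 1 f g)) (I (n + m - 1) (star_contraction n m 1 f g)) else 0)"
      using p star[of p] star_1 by (cases "p = 1") (simp_all add: integrals.orthogonal)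
  qed
  then have ZV: "cinner Z V = cinner V V" using n m by simp
  have "cinner Z Z = cinner (I n f) (I n f) * cinner (I m g) (I m g)"
    unfolding Z_def using n m by (intro free_norm_mul[OF n(3,4) _ m(3,4) free]) (simp add: trace_I)
  also have "\<dots> = cinner U U"
    unfolding U_def using n m arc_0
    by (simp add: integrals.isometry kernel_inner_self sqnorm_arc_contraction_0 enn2real_mult)
  finally have "Z = U" by (rule eq_of_cinner_eq[OF ZU])
  then have "cinner V V = cinner U V" using ZV by simp
  also have "\<dots> = 0"
    unfolding U_def V_def using n m arc_0 star_1 by (intro integrals.orthogonal) auto
  finally have "enn2real (sqnorm (n + m - 1) (star_contraction n m 1 f g)) = 0"
    unfolding V_def using star_1 by (simp add: integrals.isometry kernel_inner_self)
  then have "sqnorm (n + m - 1) (star_contraction n m 1 f g) = 0"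
    using star_1 by (auto simp: L2_kernels_iff enn2real_eq_0_iff)
  then show ?thesis
    by (simp only: sqnorm_eq_0_iff[OF L2_kernels_measurable[OF star_1]])
qed

lemma star_I_symmetric:
  assumes "f \<in> L2_kernels n" "symmetric_kernel n f"
  shows "star (I n f) = I n f"
proof -
  \<comment> \<open>symmetry is applied to the reversal of the variables, which occurs in the adjoint\<close>
  define r where "r i = (if i < n then n - 1 - i else i)" for i
  have "r permutes {..<n}"
    by (rule bij_imp_permutes) (auto simp: r_def intro!: bij_betwI[where g = "\<lambda>i. n - 1 - i"])
  then have sym: "AE x in half_line_pow n. f x = f (\<lambda>i. x (r i))"
    and real: "AE x in half_line_pow n. f x \<in> \<real>"
    using assms(2) by (auto simp: symmetric_kernel_def)
  have "AE x in half_line_pow n. kernel_adjoint n f x = f x"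
    using sym real AE_space
  proof eventually_elim
    case (elim x)
    then have "reindex n (\<lambda>i. n - 1 - i) x = (\<lambda>i. x (r i))"
      by (auto simp: reindex_def r_def space_half_line_pow PiE_iff extensional_def fun_eq_iff)
    with elim show ?case by (simp only: kernel_adjoint_eq) (metis Reals_cnj_iff)
  qed
  then show ?thesis
    using assms(1) by (subst integrals.adjoint) (auto intro: I_cong_AE L2_kernels_adjoint)
qed

end

section \<open>Disjointness of supports\<close>

text \<open>A condition on one coordinate of the support is transported to the others by transpositions.\<close>
lemma symmetric_kernel_support:
  assumes "symmetric_kernel n f" "i0 < n"
    and Q: "AE x in half_line_pow n. f x \<noteq> 0 \<longrightarrow> Q (x i0)"
  shows "AE x in half_line_pow n. f x \<noteq> 0 \<longrightarrow> (\<forall>i<n. Q (x i))"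
proof -
  have "AE x in half_line_pow n. f x \<noteq> 0 \<longrightarrow> Q (x i)" if i: "i < n" for i
  proof -
    let ?\<sigma> = "Transposition.transpose i i0"
    have \<sigma>: "?\<sigma> permutes {..<n}"
      using i assms(2) by (simp add: permutes_swap_id)
    then have "AE x in half_line_pow n. f x = f (\<lambda>j. x (?\<sigma> j))"
      using assms(1) by (simp add: symmetric_kernel_def)
    moreover have "AE x in half_line_pow n. f (reindex n ?\<sigma> x) \<noteq> 0 \<longrightarrow> Q (reindex n ?\<sigma> x i0)"
      using \<sigma> by (intro AE_reindex Q permutes_imp_bij)
    ultimately show ?thesis using AE_space
    proof eventually_elim
      case (elim x)
      have "reindex n ?\<sigma> x = (\<lambda>j. x (?\<sigma> j))"
        using elim(3) \<sigma> by (auto simp: reindex_def space_half_line_pow PiE_iff extensional_def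
            fun_eq_iff permutes_not_in)
      with elim(1,2) show ?case by simp
    qed
  qed
  then have "AE x in half_line_pow n. \<forall>i\<in>{..<n}. f x \<noteq> 0 \<longrightarrow> Q (x i)"
    by (intro AE_finite_allI) auto
  then show ?thesis by eventually_elim auto
qed

text \<open>For \<open>G(t) = \<integral> |g(t, y)|\<^sup>2 dy\<close> the hypothesis says \<open>\<integral> |f(u)|\<^sup>2 G(u\<^sub>n) du = 0\<close>, so \<open>f(u) \<noteq> 0\<close> forces the
  last coordinate of \<open>u\<close> to be a zero of \<open>G\<close>. Conversely, \<open>g\<close> vanishes almost everywhere when its first
  coordinate is a zero of \<open>G\<close>. Symmetry extends both statements to all coordinates.\<close>
lemma disjoint_supports:
  assumes "n \<ge> 1" "f \<in> L2_kernels n" "symmetric_kernel n f"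
    and "m \<ge> 1" "g \<in> L2_kernels m" "symmetric_kernel m g"
    and star: "AE x in half_line_pow (n + m - 1). star_contraction n m 1 f g x = 0"
  obtains A where "A \<in> sets half_line"
    and "AE x in half_line_pow n. f x \<noteq> 0 \<longrightarrow> (\<forall>i<n. x i \<in> A)"
    and "AE x in half_line_pow m. g x \<noteq> 0 \<longrightarrow> (\<forall>i<m. x i \<notin> A)"
proof -
  define a b where "a = n - 1" and "b = m - 1"
  have n: "n = a + 1" and m: "m = 1 + b" and nm: "n + m - 1 = n + b"
    using assms by (auto simp: a_def b_def)
  have [measurable]: "f \<in> borel_measurable (half_line_pow n)"
    "g \<in> borel_measurable (half_line_pow (1 + b))"
    using assms by (auto simp: m dest: L2_kernels_measurable)
  have [measurable]: "(\<lambda>z. join a' b' (u z) (v z)) \<in> measurable K (half_line_pow (a' + b'))"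
    if [measurable]: "u \<in> measurable K (half_line_pow a')" "v \<in> measurable K (half_line_pow b')"
    for K :: "'x measure" and u v a' b'
    using measurable_compose[OF measurable_Pair[OF that] measurable_join] by simp
  have [measurable]: "(\<lambda>x. x i) \<in> measurable (half_line_pow k) half_line" if "i < k" for i k
    unfolding half_line_pow_def using that by (intro measurable_component_singleton) auto
  have [measurable]: "(\<lambda>x. x a) \<in> measurable (half_line_pow n) half_line"
    by (simp add: n)
  interpret b: sigma_finite_measure "half_line_pow b" by (rule sigma_finite_half_line_pow)
  \<comment> \<open>a real number as a point of the first power of the half line\<close>
  define c where "c t = (\<lambda>i\<in>{..<1::nat}. t :: real)" for t
  have [measurable]: "c \<in> measurable half_line (half_line_pow 1)"
    unfolding c_def half_line_pow_def by (rule measurable_restrict) simp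
  define G where "G t = (\<integral>\<^sup>+y. ennreal (cmod (g (join 1 b (c t) y))) ^ 2 \<partial>half_line_pow b)" for t
  have [measurable]: "G \<in> borel_measurable half_line"
    unfolding G_def by measurable
  define A where "A = {t \<in> space half_line. G t = 0}"
  have A[measurable]: "A \<in> sets half_line" unfolding A_def by measurable
  have "(\<integral>\<^sup>+u. ennreal (cmod (f u)) ^ 2 * G (u a) \<partial>half_line_pow n) =
    (\<integral>\<^sup>+u. (\<integral>\<^sup>+y. ennreal (cmod (star_contraction n m 1 f g (join n b u y))) ^ 2 \<partial>half_line_pow b) \<partial>half_line_pow n)"
  proof (rule nn_integral_cong)
    fix u assume u[measurable]: "u \<in> space (half_line_pow n)"
    have u0: "u a \<in> space half_line"
      using u by (auto simp: space_half_line_pow n PiE_iff)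
    have 1: "reindex n (\<lambda>i. i) (join n b u y) = u" for y
      using u by (auto simp: reindex_def join_def space_half_line_pow PiE_iff extensional_def fun_eq_iff)
    have 2: "reindex m (\<lambda>i. n - 1 + i) (join n b u y) = join 1 b (c (u a)) y" for y
      by (auto simp: reindex_def join_def c_def n m fun_eq_iff)
    have "ennreal (cmod (f u)) ^ 2 * G (u a) =
        (\<integral>\<^sup>+y. ennreal (cmod (f u)) ^ 2 * ennreal (cmod (g (join 1 b (c (u a)) y))) ^ 2 \<partial>half_line_pow b)"
      unfolding G_def using u0 by (subst nn_integral_cmult) measurable
    then show "ennreal (cmod (f u)) ^ 2 * G (u a) =
        (\<integral>\<^sup>+y. ennreal (cmod (star_contraction n m 1 f g (join n b u y))) ^ 2 \<partial>half_line_pow b)"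
      unfolding star_contraction_1_eq[OF assms(1)] 1 2
      by (simp add: norm_mult ennreal_mult power_mult_distrib)
  qed
  also have "\<dots> = (\<integral>\<^sup>+z. ennreal (cmod (star_contraction n m 1 f g z)) ^ 2 \<partial>half_line_pow (n + b))"
  proof (rule nn_integral_join[symmetric])
    have [measurable]: "reindex n (\<lambda>i. i) \<in> measurable (half_line_pow (n + b)) (half_line_pow n)"
      "reindex m (\<lambda>i. n - 1 + i) \<in> measurable (half_line_pow (n + b)) (half_line_pow (1 + b))"
      unfolding m by (auto intro: measurable_reindex simp: n)
    show "(\<lambda>z. ennreal (cmod (star_contraction n m 1 f g z)) ^ 2) \<in> borel_measurable (half_line_pow (n + b))"
      unfolding star_contraction_1_eq[OF assms(1)] by measurable
  qed
  also have "\<dots> = (\<integral>\<^sup>+z. 0 \<partial>half_line_pow (n + b))"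
    using star unfolding nm by (intro nn_integral_cong_AE) (auto elim: eventually_mono)
  finally have "AE u in half_line_pow n. ennreal (cmod (f u)) ^ 2 * G (u a) = 0"
    by (subst nn_integral_0_iff_AE[symmetric]) simp_all
  then have f: "AE u in half_line_pow n. f u \<noteq> 0 \<longrightarrow> u a \<in> A"
    using AE_space
  proof eventually_elim
    case (elim u)
    then have "u a \<in> space half_line"
      by (auto simp: space_half_line_pow n PiE_iff)
    with elim show ?case by (auto simp: A_def)
  qed
  have M: "(\<lambda>y. ennreal (cmod (g y)) ^ 2 * indicator A (y 0)) \<in> borel_measurable (half_line_pow (1 + b))"
    by measurable
  have "(\<integral>\<^sup>+y. ennreal (cmod (g y)) ^ 2 * indicator A (y 0) \<partial>half_line_pow (1 + b)) =
    (\<integral>\<^sup>+t. (\<integral>\<^sup>+y. ennreal (cmod (g (join 1 b t y))) ^ 2 * indicator A (t 0) \<partial>half_line_pow b) \<partial>half_line_pow 1)"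
    by (subst nn_integral_join[OF M]) (auto simp: join_def)
  also have "\<dots> = (\<integral>\<^sup>+t. 0 \<partial>half_line_pow 1)"
  proof (rule nn_integral_cong)
    fix t assume t[measurable]: "t \<in> space (half_line_pow 1)"
    have tc: "c (t 0) = t"
      using t by (auto simp: c_def space_half_line_pow PiE_iff extensional_def fun_eq_iff)
    have "(\<integral>\<^sup>+y. ennreal (cmod (g (join 1 b t y))) ^ 2 * indicator A (t 0) \<partial>half_line_pow b) =
      G (t 0) * indicator A (t 0)"
      unfolding G_def tc by (rule nn_integral_multc) measurable
    also have "\<dots> = 0"
      by (simp add: A_def indicator_def)
    finally show "(\<integral>\<^sup>+y. ennreal (cmod (g (join 1 b t y))) ^ 2 * indicator A (t 0) \<partial>half_line_pow b) = 0" .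
  qed
  also have "\<dots> = 0" by simp
  finally have "(\<integral>\<^sup>+y. ennreal (cmod (g y)) ^ 2 * indicator A (y 0) \<partial>half_line_pow (1 + b)) = 0" .
  then have "AE y in half_line_pow m. ennreal (cmod (g y)) ^ 2 * indicator A (y 0) = 0"
    unfolding m by (simp only: nn_integral_0_iff_AE[OF M])
  then have g: "AE y in half_line_pow m. g y \<noteq> 0 \<longrightarrow> y 0 \<notin> A"
    by eventually_elim (auto split: split_indicator_asm)
  have "a < n" "0 < m" by (simp_all add: n m)
  then show ?thesis
    using that[OF A symmetric_kernel_support[OF assms(3) _ f] symmetric_kernel_support[OF assms(6) _ g]]
    by blast
qed

section \<open>Approximation by off-diagonal boxes\<close>

lemma sqnorm_dominated_convergence:
  assumes h0: "h0 \<in> L2_kernels n"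
    and meas: "\<And>k. hk k \<in> borel_measurable (half_line_pow n)" "h \<in> borel_measurable (half_line_pow n)"
    and bound: "\<And>k x. x \<in> space (half_line_pow n) \<Longrightarrow> cmod (hk k x) \<le> cmod (h0 x)"
    and lim: "AE x in half_line_pow n. (\<lambda>k. hk k x) \<longlonglongrightarrow> h x"
  shows "(\<lambda>k. sqnorm n (\<lambda>x. hk k x - h x)) \<longlonglongrightarrow> 0"
proof -
  note [measurable] = meas L2_kernels_measurable[OF h0]
  have h: "AE x in half_line_pow n. cmod (h x) \<le> cmod (h0 x)"
    using lim AE_space
  proof eventually_elim
    case (elim x)
    from bound[OF elim(2)] show ?case
      by (intro LIMSEQ_le_const2[OF tendsto_norm[OF elim(1)]]) auto
  qed
  have h0': "(\<lambda>x. 2 * h0 x) \<in> L2_kernels n" by (rule L2_kernels_scale[OF h0])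
  have "(\<lambda>k. \<integral>\<^sup>+x. ennreal (cmod (hk k x - h x)) ^ 2 \<partial>half_line_pow n) \<longlonglongrightarrow>
      (\<integral>\<^sup>+x. 0 \<partial>half_line_pow n)"
  proof (rule nn_integral_dominated_convergence)
    show "(\<integral>\<^sup>+x. ennreal (cmod (2 * h0 x)) ^ 2 \<partial>half_line_pow n) < \<infinity>"
      using h0' by (simp only: L2_kernels_iff sqnorm_def)
    show "AE x in half_line_pow n. ennreal (cmod (hk k x - h x)) ^ 2 \<le> ennreal (cmod (2 * h0 x)) ^ 2" for k
      using h AE_space
    proof eventually_elim
      case (elim x)
      have "cmod (hk k x - h x) \<le> cmod (2 * h0 x)"
        using norm_triangle_ineq4[of "hk k x" "h x"] bound[OF elim(2), of k] elim(1) by (simp add: norm_mult)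
      then show ?case by (intro power_mono ennreal_leI) auto
    qed
    show "AE x in half_line_pow n. (\<lambda>k. ennreal (cmod (hk k x - h x)) ^ 2) \<longlonglongrightarrow> 0"
      using lim
    proof eventually_elim
      case (elim x)
      have "(\<lambda>k. (cmod (hk k x - h x)) ^ 2) \<longlonglongrightarrow> (cmod (h x - h x)) ^ 2"
        by (intro tendsto_intros elim)
      then have "(\<lambda>k. ennreal ((cmod (hk k x - h x)) ^ 2)) \<longlonglongrightarrow> ennreal ((cmod (h x - h x)) ^ 2)"
        by (rule tendsto_ennrealI)
      then show ?case by (simp add: ennreal_power)
    qed
  qed measurable
  then show ?thesis by (simp add: sqnorm_def)
qed

text \<open>When all coordinates but the \<open>i\<close>-th are fixed, equality with the \<open>j\<close>-th one holds at a single
  value.\<close>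
lemma AE_off_diagonal: "AE x in half_line_pow n. inj_on x {..<n}"
proof -
  have "AE x in half_line_pow n. x i \<noteq> x j" if ij: "i < n" "j < n" "i \<noteq> j" for i j
  proof -
    let ?K = "{..<n} - {i}"
    let ?h = "\<lambda>x. indicator {x. x i = x j} x :: ennreal"
    have K: "insert i ?K = {..<n}" using ij by auto
    have [measurable]: "(\<lambda>x. x k) \<in> borel_measurable (half_line_pow n)" if "k < n" for k
    proof -
      have "(\<lambda>x. x k) \<in> measurable (half_line_pow n) half_line"
        unfolding half_line_pow_def using that by (intro measurable_component_singleton) auto
      moreover have "(\<lambda>t. t) \<in> borel_measurable half_line"
        unfolding half_line_def by (intro measurable_restrict_space1) simp
      ultimately show ?thesis by (rule measurable_compose)
    qed
    have meas: "(\<lambda>x. if x i = x j then 1 else 0 :: ennreal) \<in> borel_measurable (half_line_pow n)"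
      using ij by measurable
    have "(\<integral>\<^sup>+x. (if x i = x j then 1 else 0) \<partial>half_line_pow n) =
        (\<integral>\<^sup>+x. (\<integral>\<^sup>+t. (if (x(i := t)) i = (x(i := t)) j then 1 else 0) \<partial>half_line) \<partial>(\<Pi>\<^sub>M i\<in>?K. half_line))"
      using half_line.product_nn_integral_insert[of ?K i "\<lambda>x. if x i = x j then 1 else 0 :: ennreal"] meas
      by (simp add: K half_line_pow_def del: insert_Diff_single)
    also have "\<dots> = (\<integral>\<^sup>+x. 0 \<partial>(\<Pi>\<^sub>M i\<in>?K. half_line))"
    proof (rule nn_integral_cong)
      fix x assume "x \<in> space (\<Pi>\<^sub>M i\<in>?K. half_line)"
      then have "x j \<in> {0..}" using ij by (auto simp: space_PiM PiE_iff)
      then have S: "{x j} \<in> sets half_line" by (intro sets_half_lineI) auto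
      have "(\<integral>\<^sup>+t. (if (x(i := t)) i = (x(i := t)) j then 1 else 0) \<partial>half_line) =
          (\<integral>\<^sup>+t. indicator {x j} t \<partial>half_line)"
        using ij by (intro nn_integral_cong) (auto split: split_indicator)
      also have "\<dots> = 0" using S by (simp add: emeasure_half_line)
      finally show "(\<integral>\<^sup>+t. (if (x(i := t)) i = (x(i := t)) j then 1 else 0) \<partial>half_line) = 0" .
    qed
    finally have "AE x in half_line_pow n. (if x i = x j then 1 else 0 :: ennreal) = 0"
      using meas by (subst nn_integral_0_iff_AE[symmetric]) auto
    then show ?thesis by eventually_elim (auto split: if_splits)
  qed
  then have "AE x in half_line_pow n. \<forall>i\<in>{..<n}. \<forall>j\<in>{..<n}. i \<noteq> j \<longrightarrow> x i \<noteq> x j"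
    by (intro AE_finite_allI AE_impI) auto
  then show ?thesis by eventually_elim (auto simp: inj_on_def)
qed

lemma eventually_floor_scaled_inj:
  fixes x :: "nat \<Rightarrow> real"
  assumes "inj_on x {..<n}"
  shows "\<forall>\<^sub>F k in sequentially. inj_on (\<lambda>i. \<lfloor>real k * x i\<rfloor>) {..<n}"
proof -
  have "\<forall>\<^sub>F k in sequentially. \<lfloor>real k * x i\<rfloor> \<noteq> \<lfloor>real k * x j\<rfloor>" if ij: "i < n" "j < n" "i \<noteq> j" for i j
  proof -
    have d: "\<bar>x i - x j\<bar> > 0" using assms ij by (auto simp: inj_on_def)
    obtain K where K: "1 / \<bar>x i - x j\<bar> \<le> real K" using real_arch_simple by blast
    show ?thesis
      unfolding eventually_sequentially
    proof (intro exI allI impI)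
      fix k assume "K \<le> k"
      then have "1 / \<bar>x i - x j\<bar> \<le> real k" using K by linarith
      then have "1 \<le> real k * \<bar>x i - x j\<bar>" using d by (simp add: pos_divide_le_eq)
      then have "1 \<le> \<bar>real k * x i - real k * x j\<bar>" by (simp add: abs_mult flip: right_diff_distrib)
      then show "\<lfloor>real k * x i\<rfloor> \<noteq> \<lfloor>real k * x j\<rfloor>" by linarith
    qed
  qed
  then have "\<forall>\<^sub>F k in sequentially. \<forall>i\<in>{..<n}. \<forall>j\<in>{..<n}. i \<noteq> j \<longrightarrow> \<lfloor>real k * x i\<rfloor> \<noteq> \<lfloor>real k * x j\<rfloor>"
    by (auto simp: eventually_ball_finite_distrib intro: eventually_mono)
  then show ?thesis by (rule eventually_mono) (auto simp: inj_on_def)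
qed

lemma L2_kernels_indicator:
  assumes "E \<in> sets (half_line_pow n)" "emeasure (half_line_pow n) E < \<infinity>"
  shows "(indicator E :: kernel) \<in> L2_kernels n"
proof -
  have "sqnorm n (indicator E) = (\<integral>\<^sup>+x. indicator E x \<partial>half_line_pow n)"
    unfolding sqnorm_def by (intro nn_integral_cong) (auto split: split_indicator)
  then show ?thesis using assms by (simp add: L2_kernels_iff)
qed

lemma emeasure_half_line_pow_box_finite:
  assumes "\<And>i. i < n \<Longrightarrow> B i \<in> sets half_line" "\<And>i. i < n \<Longrightarrow> emeasure half_line (B i) < \<infinity>"
  shows "emeasure (half_line_pow n) (\<Pi>\<^sub>E i\<in>{..<n}. B i) < \<infinity>"
proof -
  have "(\<Prod>i<k. emeasure half_line (B i)) < \<infinity>" if "k \<le> n" for k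
    using that assms(2) by (induction k) (auto simp: ennreal_mult_less_top)
  then show ?thesis using assms(1) by (simp add: emeasure_half_line_pow_box)
qed

text \<open>Boxes with pairwise disjoint sides span a dense subspace. A bounded box is cut by a grid of mesh
  \<open>1 / k\<close>; the cells whose indices are pairwise different have pairwise disjoint sides, and
  every point of the box off the diagonals, which are null sets, lies in one of them for large \<open>k\<close>. General sets follow by a
  Dynkin argument inside a large cube, and general kernels by simple functions. A constant
  sequence in the limit case allows for changes on null sets.\<close>
lemma L2_kernels_induct [consumes 1, case_names add scale limit box]:
  assumes f: "f \<in> L2_kernels n"
    and add: "\<And>h h'. h \<in> L2_kernels n \<Longrightarrow> h' \<in> L2_kernels n \<Longrightarrow> Q h \<Longrightarrow> Q h' \<Longrightarrow> Q (\<lambda>x. h x + h' x)"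
    and scale: "\<And>c h. h \<in> L2_kernels n \<Longrightarrow> Q h \<Longrightarrow> Q (\<lambda>x. c * h x)"
    and limit: "\<And>hk h. (\<And>k :: nat. hk k \<in> L2_kernels n) \<Longrightarrow> h \<in> L2_kernels n \<Longrightarrow> (\<And>k. Q (hk k)) \<Longrightarrow>
      (\<lambda>k. sqnorm n (\<lambda>x. hk k x - h x)) \<longlonglongrightarrow> 0 \<Longrightarrow> Q h"
    and box: "\<And>B. (\<And>i. i < n \<Longrightarrow> B i \<in> sets half_line \<and> emeasure half_line (B i) < \<infinity>) \<Longrightarrow>
      disjoint_family_on B {..<n} \<Longrightarrow> Q (indicator (\<Pi>\<^sub>E i\<in>{..<n}. B i))"
  shows "Q f"
proof -
  \<comment> \<open>square-integrability is carried along, because the cases of the rule have it as a premise\<close>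
  define Q' where "Q' h \<longleftrightarrow> h \<in> L2_kernels n \<and> Q h" for h
  have zero: "Q' (\<lambda>_. 0)"
  proof -
    have e: "(indicator (\<Pi>\<^sub>E i\<in>{..<n}. {}) :: kernel) \<in> L2_kernels n"
      by (intro L2_kernels_indicator sets_half_line_pow_box emeasure_half_line_pow_box_finite) auto
    have "Q (indicator (\<Pi>\<^sub>E i\<in>{..<n}. {}))"
      by (intro box) (auto simp: disjoint_family_on_def)
    then show ?thesis using scale[OF e, of 0] L2_kernels_scale[OF e, of 0] by (simp add: Q'_def)
  qed
  have add': "Q' (\<lambda>x. h x + h' x)" if "Q' h" "Q' h'" for h h'
    using that by (auto simp: Q'_def intro: add L2_kernels_add)
  have scale': "Q' (\<lambda>x. c * h x)" if "Q' h" for c h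
    using that by (auto simp: Q'_def intro: scale L2_kernels_scale)
  have sum': "Q' (\<lambda>x. \<Sum>c\<in>C. h c x)" if "finite C" "\<And>c. c \<in> C \<Longrightarrow> Q' (h c)" for h and C :: "'c set"
    using that by (induction C rule: finite_induct) (auto intro: zero add')
  have limit': "Q' h" if "h0 \<in> L2_kernels n" "\<And>k. Q' (hk k)" "h \<in> borel_measurable (half_line_pow n)"
     "\<And>k x. x \<in> space (half_line_pow n) \<Longrightarrow> cmod (hk k x) \<le> cmod (h0 x)"
     "AE x in half_line_pow n. (\<lambda>k. hk k x) \<longlonglongrightarrow> h x" for h0 hk h
  proof -
    have hk: "hk k \<in> L2_kernels n" "Q (hk k)" for k using that(2) by (auto simp: Q'_def)
    have conv: "(\<lambda>k. sqnorm n (\<lambda>x. hk k x - h x)) \<longlonglongrightarrow> 0"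
      using hk that by (intro sqnorm_dominated_convergence[OF that(1)]) (auto dest: L2_kernels_measurable)
    have "sqnorm n h \<le> sqnorm n h0"
      unfolding sqnorm_def
    proof (rule nn_integral_mono_AE)
      show "AE x in half_line_pow n. ennreal (cmod (h x)) ^ 2 \<le> ennreal (cmod (h0 x)) ^ 2"
        using that(5) AE_space
      proof eventually_elim
        case (elim x)
        from that(4)[OF elim(2)] have "cmod (h x) \<le> cmod (h0 x)"
          by (intro LIMSEQ_le_const2[OF tendsto_norm[OF elim(1)]]) auto
        then show ?case by (intro power_mono ennreal_leI) auto
      qed
    qed
    also have "\<dots> < \<infinity>" using that(1) by (simp add: L2_kernels_iff)
    finally have "h \<in> L2_kernels n" using that(3) by (simp add: L2_kernels_iff)
    with limit[OF hk(1) this hk(2) conv] show ?thesis by (simp add: Q'_def)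
  qed
  have bounded_box: "Q' (indicator (\<Pi>\<^sub>E i\<in>{..<n}. B i))"
    if B: "\<And>i. i < n \<Longrightarrow> B i \<in> sets half_line" "\<And>i. i < n \<Longrightarrow> B i \<subseteq> {..< real R}" for B R
  proof (rule limit')
    \<comment> \<open>the grid cell \<open>[j/k, (j + 1)/k)\<close> for \<open>k > 0\<close>; for \<open>k = 0\<close> the only nonempty cell is the half line\<close>
    define cell where "cell k j = {t \<in> {0..}. \<lfloor>real k * t\<rfloor> = int j}" for k j :: nat
    have cell: "cell k j \<in> sets half_line" for k j
      unfolding cell_def by (intro sets_half_lineI) auto
    have fin: "emeasure half_line (B i \<inter> C) < \<infinity>" if "i < n" "C \<in> sets half_line" for i C
    proof -
      have "emeasure half_line (B i \<inter> C) \<le> emeasure lborel {0..real R}"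
      proof (subst emeasure_half_line)
        have "B i \<inter> C \<subseteq> {0..real R}"
          using B[OF that(1)] sets.sets_into_space[OF B(1)[OF that(1)]] by force
        then show "emeasure lborel (B i \<inter> C) \<le> emeasure lborel {0..real R}"
          by (rule emeasure_mono) simp
      qed (use B that in auto)
      also have "\<dots> < \<infinity>" by simp
      finally show ?thesis .
    qed
    have fin0: "emeasure half_line (B i) < \<infinity>" if "i < n" for i
      using fin[OF that sets.top] sets.sets_into_space[OF B(1)[OF that]] by (simp add: Int_absorb2)
    show B_L2: "(indicator (\<Pi>\<^sub>E i\<in>{..<n}. B i) :: kernel) \<in> L2_kernels n"
      using B fin0 by (intro L2_kernels_indicator sets_half_line_pow_box emeasure_half_line_pow_box_finite) auto
    define C where "C k = {c \<in> {..<n} \<rightarrow>\<^sub>E {..k * R}. inj_on c {..<n}}" for k :: nat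
    have finC: "finite (C k)" for k
      unfolding C_def by (rule finite_subset[OF _ finite_PiE[of "{..<n}" "\<lambda>_. {..k * R}"]]) auto
    define hk :: "nat \<Rightarrow> kernel" where
      "hk k x = (\<Sum>c\<in>C k. indicator (\<Pi>\<^sub>E i\<in>{..<n}. B i \<inter> cell k (c i)) x)" for k x
    show "Q' (hk k)" for k
      unfolding hk_def
    proof (rule sum'[OF finC])
      fix c assume "c \<in> C k"
      then have inj: "inj_on c {..<n}" by (simp add: C_def)
      have cells: "cell k i \<inter> cell k j = {}" if "i \<noteq> j" for i j
        using that unfolding cell_def by fastforce
      have disj: "disjoint_family_on (\<lambda>i. B i \<inter> cell k (c i)) {..<n}"
        unfolding disjoint_family_on_def
      proof (intro ballI impI)
        fix i j assume "i \<in> {..<n}" "j \<in> {..<n}" "i \<noteq> j"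
        then have "c i \<noteq> c j" using inj by (meson inj_onD)
        from cells[OF this] show "B i \<inter> cell k (c i) \<inter> (B j \<inter> cell k (c j)) = {}" by blast
      qed
      show "Q' (indicator (\<Pi>\<^sub>E i\<in>{..<n}. B i \<inter> cell k (c i)))"
      proof -
        have 1: "B i \<inter> cell k (c i) \<in> sets half_line" if "i < n" for i
          using B(1)[OF that] cell by (rule sets.Int)
        have 2: "emeasure half_line (B i \<inter> cell k (c i)) < \<infinity>" if "i < n" for i
          using that cell by (rule fin)
        show ?thesis
          unfolding Q'_def
        proof
          show "(indicator (\<Pi>\<^sub>E i\<in>{..<n}. B i \<inter> cell k (c i)) :: kernel) \<in> L2_kernels n"
            by (rule L2_kernels_indicator[OF sets_half_line_pow_box[OF 1] emeasure_half_line_pow_box_finite[OF 1 2]])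
          show "Q (indicator (\<Pi>\<^sub>E i\<in>{..<n}. B i \<inter> cell k (c i)))"
            using 1 2 disj by (rule box[OF conjI])
        qed
      qed
    qed
    show "(indicator (\<Pi>\<^sub>E i\<in>{..<n}. B i) :: kernel) \<in> borel_measurable (half_line_pow n)"
      by (rule L2_kernels_measurable[OF B_L2])
    \<comment> \<open>at most one cell contains a given point, namely the one with index \<open>d\<close> below\<close>
    have hk_eq: "hk k x = (if x \<in> (\<Pi>\<^sub>E i\<in>{..<n}. B i) \<and> inj_on (\<lambda>i. \<lfloor>real k * x i\<rfloor>) {..<n} then 1 else 0)"
      if x_space: "x \<in> space (half_line_pow n)" for k x
    proof -
      have x: "0 \<le> x i" if "i < n" for i
        using x_space that by (auto simp: space_half_line_pow PiE_iff)
      define d where "d = (\<lambda>i\<in>{..<n}. nat \<lfloor>real k * x i\<rfloor>)"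
      have fl: "\<lfloor>real k * x i\<rfloor> = int (d i)" if "i < n" for i
        using x[OF that] that by (simp add: d_def)
      have mem: "x \<in> (\<Pi>\<^sub>E i\<in>{..<n}. B i \<inter> cell k (c i)) \<longleftrightarrow> x \<in> (\<Pi>\<^sub>E i\<in>{..<n}. B i) \<and> c = d"
        if "c \<in> C k" for c
      proof -
        have cell_iff: "x i \<in> cell k (c i) \<longleftrightarrow> c i = d i" if "i < n" for i
        proof -
          have "x i \<in> cell k (c i) \<longleftrightarrow> int (d i) = int (c i)"
            using x[OF that] by (simp add: cell_def fl[OF that])
          then show ?thesis by auto
        qed
        have "c \<in> extensional {..<n}" "d \<in> extensional {..<n}"
          using that by (simp_all add: C_def d_def PiE_iff)
        then have eq_iff: "c = d \<longleftrightarrow> (\<forall>i<n. c i = d i)"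
          by (metis extensionalityI lessThan_iff)
        have "x \<in> (\<Pi>\<^sub>E i\<in>{..<n}. B i \<inter> cell k (c i)) \<longleftrightarrow>
            x \<in> (\<Pi>\<^sub>E i\<in>{..<n}. B i) \<and> (\<forall>i<n. x i \<in> cell k (c i))"
          by (simp add: PiE_iff ball_conj_distrib conj_ac Ball_def)
        also have "\<dots> \<longleftrightarrow> x \<in> (\<Pi>\<^sub>E i\<in>{..<n}. B i) \<and> (\<forall>i<n. c i = d i)"
          by (intro conj_cong refl all_cong) (rule cell_iff)
        finally show ?thesis unfolding eq_iff .
      qed
      have inj: "inj_on (\<lambda>i. \<lfloor>real k * x i\<rfloor>) {..<n} \<longleftrightarrow> inj_on d {..<n}"
      proof -
        have "inj_on (\<lambda>i. \<lfloor>real k * x i\<rfloor>) {..<n} \<longleftrightarrow> inj_on (\<lambda>i. int (d i)) {..<n}"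
          by (rule inj_on_cong) (simp add: fl)
        then show ?thesis by (simp add: inj_on_def)
      qed
      have dC: "d \<in> C k" if xB: "x \<in> (\<Pi>\<^sub>E i\<in>{..<n}. B i)" and "inj_on d {..<n}"
      proof -
        have "d i \<le> k * R" if "i < n" for i
        proof -
          have "x i \<le> real R" using PiE_mem[OF xB, of i] B(2)[OF that] that by auto
          then have "real k * x i \<le> real k * real R" by (intro mult_left_mono) auto
          then have "\<lfloor>real k * x i\<rfloor> \<le> int (k * R)" by (simp add: floor_le_iff)
          then show ?thesis using fl[OF that] by (metis of_nat_le_iff)
        qed
        moreover have "d \<in> extensional {..<n}" by (simp add: d_def)
        ultimately show ?thesis using that(2) by (simp add: C_def PiE_iff)
      qed
      have "hk k x = (\<Sum>c\<in>C k. if c = d then (if x \<in> (\<Pi>\<^sub>E i\<in>{..<n}. B i) then 1 else 0) else 0)"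
        unfolding hk_def by (intro sum.cong refl) (simp add: indicator_def mem)
      also have "\<dots> = (if d \<in> C k then (if x \<in> (\<Pi>\<^sub>E i\<in>{..<n}. B i) then 1 else 0) else 0)"
        using finC by (simp add: sum.delta)
      also have "\<dots> = (if x \<in> (\<Pi>\<^sub>E i\<in>{..<n}. B i) \<and> inj_on (\<lambda>i. \<lfloor>real k * x i\<rfloor>) {..<n} then 1 else 0)"
        unfolding inj
      proof (cases "x \<in> (\<Pi>\<^sub>E i\<in>{..<n}. B i) \<and> inj_on d {..<n}")
        case True
        with dC have "d \<in> C k" by blast
        with True show "(if d \<in> C k then (if x \<in> (\<Pi>\<^sub>E i\<in>{..<n}. B i) then 1 else 0) else 0) =
          (if x \<in> (\<Pi>\<^sub>E i\<in>{..<n}. B i) \<and> inj_on d {..<n} then 1 else 0 :: complex)" by simp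
      next
        case False
        moreover have "d \<in> C k \<Longrightarrow> inj_on d {..<n}" by (simp add: C_def)
        ultimately have "\<not> (d \<in> C k \<and> x \<in> (\<Pi>\<^sub>E i\<in>{..<n}. B i))" by blast
        with False show "(if d \<in> C k then (if x \<in> (\<Pi>\<^sub>E i\<in>{..<n}. B i) then 1 else 0) else 0) =
          (if x \<in> (\<Pi>\<^sub>E i\<in>{..<n}. B i) \<and> inj_on d {..<n} then 1 else 0 :: complex)" by auto
      qed
      finally show ?thesis .
    qed
    show "cmod (hk k x) \<le> cmod (indicator (\<Pi>\<^sub>E i\<in>{..<n}. B i) x)" if "x \<in> space (half_line_pow n)" for k x
      by (simp add: hk_eq[OF that] indicator_def)
    show "AE x in half_line_pow n. (\<lambda>k. hk k x) \<longlonglongrightarrow> indicator (\<Pi>\<^sub>E i\<in>{..<n}. B i) x"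
      using AE_off_diagonal AE_space
    proof eventually_elim
      case (elim x)
      from eventually_floor_scaled_inj[OF elim(1)] show ?case
        by (intro tendsto_eventually, elim eventually_mono) (simp add: hk_eq[OF elim(2)] indicator_def)
    qed
  qed
  \<comment> \<open>truncation keeps all measures finite, so that complements stay square-integrable\<close>
  define cube where "cube R = (\<Pi>\<^sub>E i\<in>{..<n}. {0..<real R})" for R
  have cube_meas: "cube R \<in> sets (half_line_pow n)" for R
    unfolding cube_def by (intro sets_half_line_pow_box sets_half_lineI) auto
  have cube_L2: "(indicator (E \<inter> cube R) :: kernel) \<in> L2_kernels n"
    if "E \<in> sets (half_line_pow n)" for E R
  proof (rule L2_kernels_indicator)
    have "emeasure (half_line_pow n) (E \<inter> cube R) \<le> emeasure (half_line_pow n) (cube R)"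
      by (intro emeasure_mono cube_meas) auto
    also have "\<dots> < \<infinity>"
      unfolding cube_def
    proof (rule emeasure_half_line_pow_box_finite)
      show S: "{0..<real R} \<in> sets half_line" by (intro sets_half_lineI) auto
      show "emeasure half_line {0..<real R} < \<infinity>" by (simp add: emeasure_half_line[OF S])
    qed
    finally show "emeasure (half_line_pow n) (E \<inter> cube R) < \<infinity>" .
  qed (use that cube_meas in auto)
  have sets: "Q' (indicator (E \<inter> cube R))" if "E \<in> sets (half_line_pow n)" for E R
  proof -
    let ?\<Omega> = "\<Pi>\<^sub>E i\<in>{..<n}. space half_line"
    let ?G = "prod_algebra {..<n} (\<lambda>_. half_line)"
    have S: "sets (half_line_pow n) = sigma_sets ?\<Omega> ?G"
      by (simp add: sets_half_line_pow sets_PiM)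
    have \<Omega>: "space (half_line_pow n) = ?\<Omega>" by (simp add: space_half_line_pow)
    have "E \<in> sigma_sets ?\<Omega> ?G" using that S by simp
    then show ?thesis
    proof (induction rule: sigma_sets_induct_disjoint[OF Int_stable_prod_algebra prod_algebra_sets_into_space, consumes 1])
      case (1 E)
      then obtain B where B: "E = (\<Pi>\<^sub>E i\<in>{..<n}. B i)" "\<And>i. i < n \<Longrightarrow> B i \<in> sets half_line"
        by (auto simp: prod_algebra_eq_finite Pi_iff)
      have E: "E \<inter> cube R = (\<Pi>\<^sub>E i\<in>{..<n}. B i \<inter> {0..<real R})"
        by (simp add: B cube_def PiE_Int)
      have I: "{0..<real R} \<in> sets half_line" by (intro sets_half_lineI) auto
      show ?case
        unfolding E
      proof (rule bounded_box)
        show "B i \<inter> {0..<real R} \<in> sets half_line" if "i < n" for i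
          using B(2)[OF that] I by (rule sets.Int)
        show "B i \<inter> {0..<real R} \<subseteq> {..<real R}" for i by auto
      qed
    next
      case 2
      show ?case using zero by simp
    next
      case (3 E)
      have "Q' (\<lambda>x. indicator (cube R) x + (-1) * indicator (E \<inter> cube R) x)"
      proof (intro add' scale' 3)
        show "Q' (indicator (cube R))"
          unfolding cube_def
        proof (rule bounded_box)
          show "{0..<real R} \<in> sets half_line" by (intro sets_half_lineI) auto
          show "{0..<real R} \<subseteq> {..<real R}" by auto
        qed
      qed
      moreover have "(\<lambda>x. indicator (cube R) x + (-1) * indicator (E \<inter> cube R) x) =
          (indicator ((?\<Omega> - E) \<inter> cube R) :: kernel)"
        using sets.sets_into_space[OF cube_meas[of R]] unfolding \<Omega>
        by (auto simp: fun_eq_iff indicator_def)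
      ultimately show ?case by simp
    next
      case (4 E)
      have E: "E i \<in> sets (half_line_pow n)" for i using 4(2) S by auto
      show ?case
      proof (rule limit'[OF cube_L2[OF sets.top]])
        show "Q' (\<lambda>x. \<Sum>i<k. indicator (E i \<inter> cube R) x)" for k :: nat
          using 4(3) by (intro sum') auto
        show "(indicator ((\<Union>i. E i) \<inter> cube R) :: kernel) \<in> borel_measurable (half_line_pow n)"
          using E cube_meas by (intro borel_measurable_indicator) auto
        have *: "(\<Sum>i<k. indicator (E i \<inter> cube R) x) =
            (indicator ((\<Union>i<k. E i) \<inter> cube R) x :: complex)" for k x
        proof -
          have "disjoint_family_on E {..<k}"
            using 4(1) by (rule disjoint_family_on_mono[rotated]) simp
          then have "(\<Sum>i<k. indicator (E i) x) = (indicator (\<Union>i<k. E i) x :: complex)"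
            by (subst indicator_UN_disjoint) simp_all
          then show ?thesis
            by (simp only: indicator_inter_arith sum_distrib_right[symmetric])
        qed
        show "cmod (\<Sum>i<k. indicator (E i \<inter> cube R) x)
            \<le> cmod (indicator (space (half_line_pow n) \<inter> cube R) x)"
          if "x \<in> space (half_line_pow n)" for k :: nat and x
          unfolding * using that by (simp add: indicator_def)
        show "AE x in half_line_pow n. (\<lambda>k. \<Sum>i<k. indicator (E i \<inter> cube R) x)
            \<longlonglongrightarrow> (indicator ((\<Union>i. E i) \<inter> cube R) x :: complex)"
          unfolding *
        proof (rule AE_I2)
          fix x
          show "(\<lambda>k. indicator ((\<Union>i<k. E i) \<inter> cube R) x) \<longlonglongrightarrow> (indicator ((\<Union>i. E i) \<inter> cube R) x :: complex)"
          proof (cases "\<exists>i. x \<in> E i")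
            case True
            then obtain i where i: "x \<in> E i" by blast
            have "x \<in> (\<Union>j<k. E j)" if "Suc i \<le> k" for k
              using i that by auto
            then show ?thesis
              using i by (intro tendsto_eventually eventually_sequentiallyI[of "Suc i"])
                (auto simp: indicator_def)
          next
            case False
            then show ?thesis by (simp add: indicator_def)
          qed
        qed
      qed
    qed
  qed
  obtain s where s: "\<And>k. simple_function (half_line_pow n) (s k)"
    "\<And>x. x \<in> space (half_line_pow n) \<Longrightarrow> (\<lambda>k. s k x) \<longlonglongrightarrow> f x"
    "\<And>k x. x \<in> space (half_line_pow n) \<Longrightarrow> cmod (s k x) \<le> 2 * cmod (f x)"
    using borel_measurable_implies_sequence_metric[OF L2_kernels_measurable[OF f], of 0]
    unfolding dist_norm diff_zero by blast
  let ?\<Omega> = "space (half_line_pow n)"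
  \<comment> \<open>simple approximations of \<open>f\<close>, cut off to growing cubes\<close>
  define hk where "hk k x = (\<Sum>y\<in>s k ` ?\<Omega>. y * indicator ((s k -` {y} \<inter> ?\<Omega>) \<inter> cube k) x)" for k x
  have hk_eq: "hk k x = s k x * indicator (cube k) x" if "x \<in> ?\<Omega>" for k x
  proof -
    have "hk k x = (\<Sum>y\<in>s k ` ?\<Omega>. if y = s k x then s k x * indicator (cube k) x else 0)"
      unfolding hk_def using that by (intro sum.cong) (auto split: split_indicator)
    also have "\<dots> = s k x * indicator (cube k) x"
      using s(1)[of k] that by (subst sum.delta) (auto simp: simple_function_def)
    finally show ?thesis .
  qed
  have "Q' f"
  proof (rule limit'[OF L2_kernels_scale[OF f, of 2]])
    show "Q' (hk k)" for k
      unfolding hk_def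
    proof (intro sum' scale' sets)
      show "finite (s k ` ?\<Omega>)" "s k -` {y} \<inter> ?\<Omega> \<in> sets (half_line_pow n)" for y
        using s(1)[of k] by (auto intro: simple_functionD)
    qed
    show "f \<in> borel_measurable (half_line_pow n)" by (rule L2_kernels_measurable[OF f])
    show "cmod (hk k x) \<le> cmod (2 * f x)" if "x \<in> ?\<Omega>" for k x
      using s(3)[OF that, of k] by (auto simp: hk_eq[OF that] norm_mult split: split_indicator)
    show "AE x in half_line_pow n. (\<lambda>k. hk k x) \<longlonglongrightarrow> f x"
    proof (rule AE_I2)
      fix x assume x: "x \<in> ?\<Omega>"
      obtain K where K: "Max (insert 0 (x ` {..<n})) < real K" using reals_Archimedean2 by blast
      have "x \<in> cube k" if "K \<le> k" for k
      proof -
        have "x i < real k" if "i < n" for i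
          using K Max_ge[of "insert 0 (x ` {..<n})" "x i"] that \<open>K \<le> k\<close> by force
        then show ?thesis using x by (auto simp: cube_def space_half_line_pow PiE_iff)
      qed
      then have "\<forall>\<^sub>F k in sequentially. hk k x = s k x"
        by (intro eventually_sequentiallyI[of K]) (simp add: hk_eq[OF x])
      then show "(\<lambda>k. hk k x) \<longlonglongrightarrow> f x"
        using s(2)[OF x] by (simp add: tendsto_cong)
    qed
  qed
  then show ?thesis by (simp add: Q'_def)
qed

section \<open>Symmetrization\<close>

lemma symmetrization_eq:
  assumes "x \<in> space (half_line_pow n)"
  shows "symmetrization n f x = (\<Sum>\<sigma> | \<sigma> permutes {..<n}. f (reindex n \<sigma> x)) / fact n"
proof -
  have "(\<lambda>i. x (\<sigma> i)) = reindex n \<sigma> x" if "\<sigma> permutes {..<n}" for \<sigma>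
    using that assms by (auto simp: reindex_def space_half_line_pow PiE_iff extensional_def
        fun_eq_iff permutes_not_in)
  then show ?thesis by (simp add: symmetrization_def)
qed

lemma measurable_symmetrization:
  assumes "f \<in> L2_kernels n" shows "symmetrization n f \<in> borel_measurable (half_line_pow n)"
proof -
  have "(\<lambda>x. (\<Sum>\<sigma> | \<sigma> permutes {..<n}. f (reindex n \<sigma> x)) / fact n) \<in> borel_measurable (half_line_pow n)"
    by (intro borel_measurable_divide borel_measurable_sum borel_measurable_const
        measurable_compose[OF measurable_reindex_bij L2_kernels_measurable[OF assms]])
       (auto intro: permutes_imp_bij)
  then show ?thesis
    by (rule measurable_cong[THEN iffD1, rotated]) (simp add: symmetrization_eq)
qed

text \<open>Symmetrization is an average of isometries.\<close>
lemma sqnorm_symmetrization_le: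
  assumes f: "f \<in> L2_kernels n" shows "sqnorm n (symmetrization n f) \<le> sqnorm n f"
proof -
  let ?S = "{\<sigma>. \<sigma> permutes {..<n}}"
  note [measurable] = L2_kernels_measurable[OF f]
  have fin: "finite ?S" by (simp add: finite_permutations)
  have card: "card ?S = fact n" by (simp add: card_permutations)
  have re: "(\<lambda>x. f (reindex n \<sigma> x)) \<in> borel_measurable (half_line_pow n)"
    "sqnorm n (\<lambda>x. f (reindex n \<sigma> x)) = sqnorm n f" if "\<sigma> \<in> ?S" for \<sigma>
    using that by (auto intro!: sqnorm_reindex L2_kernels_measurable[OF L2_kernels_reindex[OF f]] permutes_imp_bij
        L2_kernels_measurable[OF f])
  have "sqnorm n (symmetrization n f) \<le>
      (\<integral>\<^sup>+x. (\<Sum>\<sigma>\<in>?S. ennreal (1 / fact n) * ennreal (cmod (f (reindex n \<sigma> x))) ^ 2) \<partial>half_line_pow n)"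
    unfolding sqnorm_def
  proof (rule nn_integral_mono)
    fix x assume x: "x \<in> space (half_line_pow n)"
    have "(cmod (symmetrization n f x))\<^sup>2 \<le> ((\<Sum>\<sigma>\<in>?S. cmod (f (reindex n \<sigma> x))) / fact n)\<^sup>2"
      unfolding symmetrization_eq[OF x] norm_divide
      by (intro power_mono) (auto intro!: divide_right_mono norm_sum)
    also have "\<dots> \<le> ((\<Sum>\<sigma>\<in>?S. (cmod (f (reindex n \<sigma> x)))\<^sup>2) * card ?S) / (fact n)\<^sup>2"
      unfolding power_divide by (intro divide_right_mono sum_squared_le_sum_of_squares) simp
    also have "\<dots> = (\<Sum>\<sigma>\<in>?S. 1 / fact n * (cmod (f (reindex n \<sigma> x)))\<^sup>2)"
      unfolding card by (simp add: power2_eq_square sum_divide_distrib)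
    finally have "ennreal ((cmod (symmetrization n f x))\<^sup>2) \<le>
        ennreal (\<Sum>\<sigma>\<in>?S. 1 / fact n * (cmod (f (reindex n \<sigma> x)))\<^sup>2)"
      by (rule ennreal_leI)
    also have "\<dots> = (\<Sum>\<sigma>\<in>?S. ennreal (1 / fact n) * ennreal ((cmod (f (reindex n \<sigma> x)))\<^sup>2))"
    proof -
      have "(\<Sum>\<sigma>\<in>?S. ennreal (1 / fact n) * ennreal ((cmod (f (reindex n \<sigma> x)))\<^sup>2)) =
          (\<Sum>\<sigma>\<in>?S. ennreal (1 / fact n * (cmod (f (reindex n \<sigma> x)))\<^sup>2))"
        by (intro sum.cong refl ennreal_mult[symmetric]) auto
      also have "\<dots> = ennreal (\<Sum>\<sigma>\<in>?S. 1 / fact n * (cmod (f (reindex n \<sigma> x)))\<^sup>2)"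
        by (rule sum_ennreal) auto
      finally show ?thesis by (rule sym)
    qed
    finally show "(ennreal (cmod (symmetrization n f x)))\<^sup>2 \<le>
        (\<Sum>\<sigma>\<in>?S. ennreal (1 / fact n) * (ennreal (cmod (f (reindex n \<sigma> x))))\<^sup>2)"
      by (simp add: ennreal_power)
  qed
  also have "\<dots> = (\<Sum>\<sigma>\<in>?S. ennreal (1 / fact n) * sqnorm n (\<lambda>x. f (reindex n \<sigma> x)))"
    unfolding sqnorm_def using re(1) by (subst nn_integral_sum) (auto intro!: sum.cong nn_integral_cmult)
  also have "\<dots> = (\<Sum>\<sigma>\<in>?S. ennreal (1 / fact n) * sqnorm n f)"
    by (intro sum.cong refl) (simp only: re(2))
  also have "\<dots> = ennreal (real (card ?S)) * ennreal (1 / fact n) * sqnorm n f"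
    by (simp add: ennreal_of_nat_eq_real_of_nat mult.assoc)
  also have "ennreal (real (card ?S)) * ennreal (1 / fact n) = 1"
    unfolding card by (subst ennreal_mult[symmetric]) auto
  finally show ?thesis by simp
qed

section \<open>Independence over disjoint sets\<close>

text \<open>A generator that is closed under intersections; the sets \<open>B\<close> may overlap, which makes closedness
  immediate and leaves the decomposition into disjoint sets to the proof of independence.\<close>
definition count_events :: "'w measure \<Rightarrow> ('w \<Rightarrow> real measure) \<Rightarrow> real set \<Rightarrow> 'w set set" where
  "count_events M \<eta> A = {{w \<in> space M. \<forall>p\<in>R. emeasure (\<eta> w) (fst p) \<in> snd p} | R.
     finite R \<and> (\<forall>p\<in>R. fst p \<in> sets half_line \<and> fst p \<subseteq> A \<and> snd p \<in> sets borel)}"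

definition local_sigma :: "'w measure \<Rightarrow> ('w \<Rightarrow> real measure) \<Rightarrow> real set \<Rightarrow> 'w measure" where
  "local_sigma M \<eta> A = sigma (space M) (count_events M \<eta> A)"

lemma count_events_Pow: "count_events M \<eta> A \<subseteq> Pow (space M)"
  by (auto simp: count_events_def)

lemma space_local_sigma [simp]: "space (local_sigma M \<eta> A) = space M"
  by (simp add: local_sigma_def space_measure_of_conv)

lemma sets_local_sigma: "sets (local_sigma M \<eta> A) = sigma_sets (space M) (count_events M \<eta> A)"
  unfolding local_sigma_def by (rule sets_measure_of[OF count_events_Pow])

lemma measurable_count_local_sigma:
  assumes "B \<in> sets half_line" "B \<subseteq> A"
  shows "(\<lambda>w. emeasure (\<eta> w) B) \<in> borel_measurable (local_sigma M \<eta> A)"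
proof (rule measurableI)
  fix S :: "ennreal set" assume S: "S \<in> sets borel"
  have "{w \<in> space M. \<forall>p\<in>{(B, S)}. emeasure (\<eta> w) (fst p) \<in> snd p} \<in> count_events M \<eta> A"
    unfolding count_events_def using assms S by (intro CollectI exI[of _ "{(B, S)}"]) simp
  moreover have "(\<lambda>w. emeasure (\<eta> w) B) -` S \<inter> space (local_sigma M \<eta> A) =
      {w \<in> space M. \<forall>p\<in>{(B, S)}. emeasure (\<eta> w) (fst p) \<in> snd p}"
    by auto
  ultimately show "(\<lambda>w. emeasure (\<eta> w) B) -` S \<inter> space (local_sigma M \<eta> A) \<in> sets (local_sigma M \<eta> A)"
    by (simp add: sets_local_sigma sigma_sets.Basic)
qed simp

lemma Int_stable_count_events: "Int_stable (count_events M \<eta> A)"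
proof (rule Int_stableI)
  fix U V assume "U \<in> count_events M \<eta> A" "V \<in> count_events M \<eta> A"
  then obtain R R' where
    U: "U = {w \<in> space M. \<forall>p\<in>R. emeasure (\<eta> w) (fst p) \<in> snd p}" "finite R"
      "\<forall>p\<in>R. fst p \<in> sets half_line \<and> fst p \<subseteq> A \<and> snd p \<in> sets borel" and
    V: "V = {w \<in> space M. \<forall>p\<in>R'. emeasure (\<eta> w) (fst p) \<in> snd p}" "finite R'"
      "\<forall>p\<in>R'. fst p \<in> sets half_line \<and> fst p \<subseteq> A \<and> snd p \<in> sets borel"
    unfolding count_events_def by blast
  have "U \<inter> V = {w \<in> space M. \<forall>p\<in>R \<union> R'. emeasure (\<eta> w) (fst p) \<in> snd p}"
    unfolding U(1) V(1) by blast
  then show "U \<inter> V \<in> count_events M \<eta> A"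
    unfolding count_events_def using U(2,3) V(2,3) by (intro CollectI exI[of _ "R \<union> R'"]) (simp add: ball_Un)
qed

text \<open>The atoms of the finite algebra generated by \<open>H\<close>: two points are in the same atom if they lie in
  the same members of \<open>H\<close>.\<close>
lemma finite_sets_atoms:
  assumes "finite H" "\<And>B. B \<in> H \<Longrightarrow> B \<in> sets K"
  obtains D where "finite D" "disjoint D" "{} \<notin> D" "\<And>C. C \<in> D \<Longrightarrow> C \<in> sets K"
    "\<And>B. B \<in> H \<Longrightarrow> B = \<Union>{C\<in>D. C \<subseteq> B}"
proof -
  define atom where "atom T = {y \<in> \<Union>H. {B \<in> H. y \<in> B} = T}" for T
  define D where "D = {C. \<exists>x\<in>\<Union>H. C = atom {B \<in> H. x \<in> B}}"
  have "D \<subseteq> atom ` Pow H" by (auto simp: D_def)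
  then have "finite D" using assms(1) by (meson finite_Pow_iff finite_imageI finite_subset)
  moreover have "disjoint D"
    unfolding disjoint_def
  proof (intro ballI impI)
    fix C C' assume "C \<in> D" "C' \<in> D" "C \<noteq> C'"
    moreover obtain T T' where "C = atom T" "C' = atom T'"
      using \<open>C \<in> D\<close> \<open>C' \<in> D\<close> by (auto simp: D_def)
    ultimately have "C = atom T" "C' = atom T'" "T \<noteq> T'" by auto
    then show "C \<inter> C' = {}" by (auto simp: atom_def)
  qed
  moreover have "{} \<notin> D" by (auto simp: D_def atom_def)
  moreover have "C \<in> sets K" if "C \<in> D" for C
  proof -
    obtain T where T: "C = atom T" "T \<subseteq> H" using \<open>C \<in> D\<close> by (auto simp: D_def)
    have "atom T = \<Union>H - \<Union>(H - T) - (\<Union>B\<in>T. \<Union>H - B)"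
      using T(2) by (auto simp: atom_def)
    also have "\<dots> \<in> sets K"
      using assms T(2) finite_subset[OF T(2) assms(1)]
      by (intro sets.Diff sets.finite_Union sets.finite_UN) auto
    finally show ?thesis by (simp add: T)
  qed
  moreover have "B = \<Union>{C\<in>D. C \<subseteq> B}" if "B \<in> H" for B
  proof (intro equalityI subsetI)
    fix x assume x: "x \<in> B"
    let ?C = "atom {B \<in> H. x \<in> B}"
    have "?C \<in> D" using x that by (auto simp: D_def)
    moreover have "x \<in> ?C" "?C \<subseteq> B" using x that by (auto simp: atom_def)
    ultimately show "x \<in> \<Union>{C\<in>D. C \<subseteq> B}" by blast
  qed auto
  ultimately show ?thesis by (rule that)
qed

context poisson_random_measure
begin

lemma count_events_events: "count_events M \<eta> A \<subseteq> events"
proof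
  fix U assume "U \<in> count_events M \<eta> A"
  then obtain R where U: "U = {w \<in> space M. \<forall>p\<in>R. emeasure (\<eta> w) (fst p) \<in> snd p}" "finite R"
    "\<And>p. p \<in> R \<Longrightarrow> fst p \<in> sets half_line" "\<And>p. p \<in> R \<Longrightarrow> snd p \<in> sets borel"
    unfolding count_events_def by blast
  have "{w \<in> space M. emeasure (\<eta> w) (fst p) \<in> snd p} \<in> events" if "p \<in> R" for p
    using measurable_sets[OF measurable_random[OF U(3)[OF that]] U(4)[OF that]]
    by (simp add: vimage_def Int_def conj_commute)
  then show "U \<in> events"
    unfolding U(1) using U(2) by (intro sets.sets_Collect_finite_All) auto
qed

lemma sets_local_sigma_subset: "sets (local_sigma M \<eta> A) \<subseteq> events"
  unfolding sets_local_sigma by (rule sets.sigma_sets_subset[OF count_events_events])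

lemma count_eq_sum_atoms:
  assumes w: "w \<in> space M" and h: "inj_on h K" "finite K" "\<And>i. i \<in> K \<Longrightarrow> h i \<in> sets half_line"
    "disjoint (h ` K)" and B: "B = \<Union>{C \<in> h ` K. C \<subseteq> B}"
  shows "emeasure (\<eta> w) B = (\<Sum>i | i \<in> K \<and> h i \<subseteq> B. emeasure (\<eta> w) (h i))"
proof -
  have "B = (\<Union>i\<in>{i \<in> K. h i \<subseteq> B}. h i)" using B by blast
  moreover have "disjoint_family_on h {i \<in> K. h i \<subseteq> B}"
    by (rule disjoint_family_on_mono[OF _ disjoint_image_disjoint_family_on[OF h(4,1)]]) auto
  ultimately show ?thesis
    using h(2,3) sets_random[OF w]
    by (subst sum_emeasure) auto
qed

text \<open>The finitely many sets that occur in the two events are cut into atoms. The counts of the atoms are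
  independent, and each event depends only on the atoms contained in \<open>A\<close> or \<open>A'\<close>, respectively. An atom
  is nonempty, so it cannot be contained in both.\<close>
lemma count_events_indep:
  assumes A: "A \<inter> A' = {}" and U: "U \<in> count_events M \<eta> A" and V: "V \<in> count_events M \<eta> A'"
  shows "prob (U \<inter> V) = prob U * prob V"
proof -
  have repr: "\<exists>R. W = {w \<in> space M. \<forall>p\<in>R. emeasure (\<eta> w) (fst p) \<in> snd p} \<and> finite R \<and>
      (\<forall>p\<in>R. fst p \<in> sets half_line \<and> fst p \<subseteq> C \<and> snd p \<in> sets borel)"
    if "W \<in> count_events M \<eta> C" for W C
    using that by (simp only: count_events_def mem_Collect_eq)
  obtain R where U: "U = {w \<in> space M. \<forall>p\<in>R. emeasure (\<eta> w) (fst p) \<in> snd p}" and R: "finite R"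
      "\<forall>p\<in>R. fst p \<in> sets half_line \<and> fst p \<subseteq> A \<and> snd p \<in> sets borel"
    using repr[OF U] by (elim exE conjE)
  obtain R' where V: "V = {w \<in> space M. \<forall>p\<in>R'. emeasure (\<eta> w) (fst p) \<in> snd p}" and R': "finite R'"
      "\<forall>p\<in>R'. fst p \<in> sets half_line \<and> fst p \<subseteq> A' \<and> snd p \<in> sets borel"
    using repr[OF V] by (elim exE conjE)
  have fin: "finite (fst ` (R \<union> R'))" and mem: "\<And>B. B \<in> fst ` (R \<union> R') \<Longrightarrow> B \<in> sets half_line"
    using R R' by auto
  obtain D where D: "finite D" "disjoint D" "{} \<notin> D" "\<And>C. C \<in> D \<Longrightarrow> C \<in> sets half_line"
    "\<And>B. B \<in> fst ` (R \<union> R') \<Longrightarrow> B = \<Union>{C\<in>D. C \<subseteq> B}"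
    using finite_sets_atoms[OF fin mem] by blast
  obtain h where h: "bij_betw h {0..<card D} D"
    using ex_bij_betw_nat_finite[OF D(1)] by blast
  define K where "K = {0..<card D}"
  have K: "finite K" "inj_on h K" "h ` K = D"
    using h by (auto simp: K_def bij_betw_def)
  have hK: "h i \<in> sets half_line" "h i \<noteq> {}" if "i \<in> K" for i
    using that K D(3,4) by auto
  have disj: "disjoint_family_on h K"
    using K(2,3) D(2) by (intro disjoint_image_disjoint_family_on) simp_all
  define X where "X i w = emeasure (\<eta> w) (h i)" for i w
  have indep: "indep_vars (\<lambda>_. borel) X K"
    unfolding X_def using K hK disj by (intro independent) auto
  define Ka where "Ka = {i \<in> K. h i \<subseteq> A}"
  define Kb where "Kb = {i \<in> K. h i \<subseteq> A'}"
  have "\<not> (h i \<subseteq> A \<and> h i \<subseteq> A')" if "i \<in> K" for i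
    using hK(2)[OF that] A by blast
  then have "Ka \<inter> Kb = {}" "Ka \<subseteq> K" "Kb \<subseteq> K"
    by (auto simp: Ka_def Kb_def)
  note ind = indep_var_restrict[OF indep this]
  have sum: "emeasure (\<eta> w) B = (\<Sum>i | i \<in> K \<and> h i \<subseteq> B. X i w)"
    if "w \<in> space M" "B \<in> fst ` (R \<union> R')" for w B
    unfolding X_def
  proof (rule count_eq_sum_atoms[OF that(1) K(2,1) hK(1)])
    show "disjoint (h ` K)" using D(2) K(3) by simp
    show "B = \<Union>{C \<in> h ` K. C \<subseteq> B}" using D(5)[OF that(2)] K(3) by simp
  qed
  define E where "E L T = {x \<in> space (\<Pi>\<^sub>M i\<in>L. borel). \<forall>p\<in>T. (\<Sum>i | i \<in> L \<and> h i \<subseteq> fst p. x i) \<in> snd p}"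
    for L and T :: "(real set \<times> ennreal set) set"
  have meas: "E L T \<in> sets (\<Pi>\<^sub>M i\<in>L. borel :: ennreal measure)"
    if "finite T" "\<And>p. p \<in> T \<Longrightarrow> snd p \<in> sets borel" for L T
    unfolding E_def
  proof (intro sets.sets_Collect_finite_All that(1))
    fix p assume p: "p \<in> T"
    have "(\<lambda>x. \<Sum>i | i \<in> L \<and> h i \<subseteq> fst p. x i) \<in> borel_measurable (\<Pi>\<^sub>M i\<in>L. borel :: ennreal measure)"
      by (intro borel_measurable_sum measurable_component_singleton) auto
    from measurable_sets[OF this that(2)[OF p]]
    show "{x \<in> space (\<Pi>\<^sub>M i\<in>L. borel). (\<Sum>i | i \<in> L \<and> h i \<subseteq> fst p. x i) \<in> snd p} \<in>
      sets (\<Pi>\<^sub>M i\<in>L. borel :: ennreal measure)"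
      by (simp add: vimage_def Int_def conj_commute)
  qed
  have vimage: "(\<lambda>w. restrict (\<lambda>i. X i w) L) -` E L T \<inter> space M =
      {w \<in> space M. \<forall>p\<in>T. emeasure (\<eta> w) (fst p) \<in> snd p}"
    if T: "T \<subseteq> R \<union> R'" and L: "\<And>p i. p \<in> T \<Longrightarrow> i \<in> K \<Longrightarrow> h i \<subseteq> fst p \<longleftrightarrow> i \<in> L \<and> h i \<subseteq> fst p" and "L \<subseteq> K"
    for L T
  proof -
    have "emeasure (\<eta> w) (fst p) = (\<Sum>i | i \<in> L \<and> h i \<subseteq> fst p. restrict (\<lambda>i. X i w) L i)"
      if "w \<in> space M" "p \<in> T" for w p
    proof -
      have "emeasure (\<eta> w) (fst p) = (\<Sum>i | i \<in> K \<and> h i \<subseteq> fst p. X i w)"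
        using that T by (intro sum) auto
      also have "{i. i \<in> K \<and> h i \<subseteq> fst p} = {i. i \<in> L \<and> h i \<subseteq> fst p}"
        using L[OF that(2)] \<open>L \<subseteq> K\<close> by blast
      finally show ?thesis by simp
    qed
    then show ?thesis unfolding E_def by (auto simp: space_PiM)
  qed
  have U': "(\<lambda>w. restrict (\<lambda>i. X i w) Ka) -` E Ka R \<inter> space M = U"
    unfolding U using R(2) by (intro vimage) (auto simp: Ka_def)
  have V': "(\<lambda>w. restrict (\<lambda>i. X i w) Kb) -` E Kb R' \<inter> space M = V"
    unfolding V using R'(2) by (intro vimage) (auto simp: Kb_def)
  have "prob ((\<lambda>w. (restrict (\<lambda>i. X i w) Ka, restrict (\<lambda>i. X i w) Kb)) -` (E Ka R \<times> E Kb R') \<inter> space M) =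
      prob ((\<lambda>w. restrict (\<lambda>i. X i w) Ka) -` E Ka R \<inter> space M) * prob ((\<lambda>w. restrict (\<lambda>i. X i w) Kb) -` E Kb R' \<inter> space M)"
    using R R' by (intro indep_varD[OF ind] meas) auto
  moreover have "(\<lambda>w. (restrict (\<lambda>i. X i w) Ka, restrict (\<lambda>i. X i w) Kb)) -` (E Ka R \<times> E Kb R') \<inter> space M =
      ((\<lambda>w. restrict (\<lambda>i. X i w) Ka) -` E Ka R \<inter> space M) \<inter> ((\<lambda>w. restrict (\<lambda>i. X i w) Kb) -` E Kb R' \<inter> space M)"
    by auto
  ultimately show ?thesis by (simp only: U' V')
qed

lemma local_sigma_indep:
  assumes "A \<inter> A' = {}"
  shows "indep_set (sets (local_sigma M \<eta> A)) (sets (local_sigma M \<eta> A'))"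
  unfolding sets_local_sigma
  using count_events_events count_events_indep[OF assms]
  by (intro indep_set_sigma_sets indep_setI Int_stable_count_events)

lemma indep_var_local:
  fixes Z Z' :: "'w \<Rightarrow> complex"
  assumes A: "A \<inter> A' = {}"
    and Z: "Z \<in> borel_measurable (local_sigma M \<eta> A)" "Z' \<in> borel_measurable (local_sigma M \<eta> A')"
  shows "indep_var borel Z borel Z'"
  unfolding indep_var_eq
proof (intro conjI)
  have sub: "Y \<in> borel_measurable M" if "Y \<in> borel_measurable (local_sigma M \<eta> C)"
    for Y :: "'w \<Rightarrow> complex" and C
    using that sets_local_sigma_subset[of C] by (auto simp: measurable_def)
  show "random_variable borel Z" "random_variable borel Z'"
    using Z by (auto intro: sub)
  have sig: "sigma_sets (space M) {Y -` S \<inter> space M | S. S \<in> sets borel} \<subseteq> sets (local_sigma M \<eta> C)"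
    if "Y \<in> borel_measurable (local_sigma M \<eta> C)" for Y :: "'w \<Rightarrow> complex" and C
    using sets.sigma_sets_subset[of "{Y -` S \<inter> space M | S. S \<in> sets borel}" "local_sigma M \<eta> C"]
      measurable_sets[OF that] by auto
  show "indep_set (sigma_sets (space M) {Z -` S \<inter> space M | S. S \<in> sets borel})
      (sigma_sets (space M) {Z' -` S \<inter> space M | S. S \<in> sets borel})"
    unfolding indep_sets2_eq
    using local_sigma_indep[OF A] sig[OF Z(1)] sig[OF Z(2)] unfolding indep_sets2_eq by blast
qed

end

section \<open>Locality of the Wiener--Ito integral\<close>

locale poisson_integral_setting =
  poisson_random_measure M \<eta> + integrals: poisson_multiple_integral M \<eta> J
  for M :: "'w measure" and \<eta> :: "'w \<Rightarrow> real measure" and J :: "nat \<Rightarrow> kernel \<Rightarrow> 'w \<Rightarrow> complex"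
begin

lemma J_norm_le:
  assumes h: "h \<in> L2_kernels n"
  shows "(\<integral>\<^sup>+w. ennreal (cmod (J n h w)) ^ 2 \<partial>M) \<le> ennreal (fact n) * sqnorm n h"
proof -
  have s_le: "sqnorm n (symmetrization n h) \<le> sqnorm n h"
    by (rule sqnorm_symmetrization_le[OF h])
  also have "\<dots> < \<infinity>" using h by (simp add: L2_kernels_iff)
  finally have s: "symmetrization n h \<in> L2_kernels n"
    using measurable_symmetrization[OF h] by (simp add: L2_kernels_iff)
  then have fin: "sqnorm n (symmetrization n h) \<noteq> top" by (auto simp: L2_kernels_iff)
  have "complex_of_real (\<integral>w. (cmod (J n h w))\<^sup>2 \<partial>M) = (\<integral>w. J n h w * cnj (J n h w) \<partial>M)"
    by (simp only: complex_norm_square integral_complex_of_real[symmetric])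
  also have "\<dots> = complex_of_real (fact n * enn2real (sqnorm n (symmetrization n h)))"
    by (simp add: integrals.isometry[OF h h] kernel_inner_self[OF s])
  finally have eq: "(\<integral>w. (cmod (J n h w))\<^sup>2 \<partial>M) = fact n * enn2real (sqnorm n (symmetrization n h))"
    using of_real_eq_iff by blast
  have "(\<integral>\<^sup>+w. ennreal (cmod (J n h w)) ^ 2 \<partial>M) = ennreal (\<integral>w. (cmod (J n h w))\<^sup>2 \<partial>M)"
    using nn_integral_eq_integral[OF integrals.square_integrable[OF h]] by (simp add: ennreal_power)
  also have "\<dots> = ennreal (fact n) * sqnorm n (symmetrization n h)"
    unfolding eq using fin by (simp add: ennreal_mult less_top)
  also have "\<dots> \<le> ennreal (fact n) * sqnorm n h"
    by (rule mult_left_mono[OF s_le]) simp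
  finally show ?thesis .
qed

text \<open>The estimate behind all limits: the multiple integral is bounded from \<open>L\<^sup>2\<close> kernels to
  \<open>L\<^sup>2(M)\<close>.\<close>
lemma J_dist_le:
  assumes h: "h \<in> L2_kernels n" and h': "h' \<in> L2_kernels n"
  shows "(\<integral>\<^sup>+w. ennreal (cmod (J n h w - J n h' w)) ^ 2 \<partial>M) \<le> ennreal (fact n) * sqnorm n (\<lambda>x. h x - h' x)"
proof -
  have "AE w in M. J n (\<lambda>x. h x + (-1) * h' x) w = J n h w + J n (\<lambda>x. (-1) * h' x) w"
    by (rule integrals.add[OF h L2_kernels_scale[OF h']])
  moreover have "AE w in M. J n (\<lambda>x. (-1) * h' x) w = (-1) * J n h' w"
    by (rule integrals.scale[OF h'])
  ultimately have "AE w in M. J n h w - J n h' w = J n (\<lambda>x. h x + (-1) * h' x) w"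
    by eventually_elim simp
  then have "(\<integral>\<^sup>+w. ennreal (cmod (J n h w - J n h' w)) ^ 2 \<partial>M) =
      (\<integral>\<^sup>+w. ennreal (cmod (J n (\<lambda>x. h x + (-1) * h' x) w)) ^ 2 \<partial>M)"
    by (intro nn_integral_cong_AE) (auto elim: eventually_mono)
  also have "\<dots> \<le> ennreal (fact n) * sqnorm n (\<lambda>x. h x + (-1) * h' x)"
    by (rule J_norm_le[OF L2_kernels_diff[OF h h']])
  finally show ?thesis by simp
qed

lemma J_cong_AE:
  assumes h: "h \<in> L2_kernels n" and h': "h' \<in> L2_kernels n"
    and eq: "AE x in half_line_pow n. h x = h' x"
  shows "AE w in M. J n h w = J n h' w"
proof -
  note [measurable] = integrals.measurable[OF h] integrals.measurable[OF h']
  have "sqnorm n (\<lambda>x. h x - h' x) = 0"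
    using eq h h' by (subst sqnorm_eq_0_iff) (auto intro!: borel_measurable_diff dest: L2_kernels_measurable)
  then have "(\<integral>\<^sup>+w. ennreal (cmod (J n h w - J n h' w)) ^ 2 \<partial>M) = 0"
    using J_dist_le[OF h h'] by simp
  then have "AE w in M. ennreal (cmod (J n h w - J n h' w)) ^ 2 = 0"
    by (subst (asm) nn_integral_0_iff_AE) simp_all
  then show ?thesis by eventually_elim simp
qed

text \<open>The version \<open>Z\<close> is needed because the integrals are given only almost surely and
  \<open>local_sigma\<close> need not contain the null sets.\<close>
definition determined_on :: "real set \<Rightarrow> ('w \<Rightarrow> complex) \<Rightarrow> bool" where
  "determined_on A Y \<longleftrightarrow> (\<exists>Z\<in>borel_measurable (local_sigma M \<eta> A). AE w in M. Y w = Z w)"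

lemma determined_onI:
  "Z \<in> borel_measurable (local_sigma M \<eta> A) \<Longrightarrow> AE w in M. Y w = Z w \<Longrightarrow> determined_on A Y"
  unfolding determined_on_def by (rule bexI[of _ Z])

lemma determined_onE:
  assumes "determined_on A Y"
  obtains Z where "Z \<in> borel_measurable (local_sigma M \<eta> A)" "AE w in M. Y w = Z w"
  using assms unfolding determined_on_def by (elim bexE)

text \<open>Along a subsequence the integrals converge almost surely, and the pointwise limit of the versions is
  again measurable.\<close>
lemma determined_on_limit:
  assumes hk: "\<And>k. hk k \<in> L2_kernels n" and h: "h \<in> L2_kernels n"
    and conv: "(\<lambda>k. sqnorm n (\<lambda>x. hk k x - h x)) \<longlonglongrightarrow> 0"
    and loc: "\<And>k. determined_on A (J n (hk k))"
  shows "determined_on A (J n h)"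
proof -
  obtain Z where Z: "\<And>k. Z k \<in> borel_measurable (local_sigma M \<eta> A)" "\<And>k. AE w in M. J n (hk k) w = Z k w"
  proof -
    have "\<forall>k. \<exists>Z. Z \<in> borel_measurable (local_sigma M \<eta> A) \<and> (AE w in M. J n (hk k) w = Z w)"
      using loc unfolding determined_on_def by blast
    from choice[OF this] show ?thesis using that by blast
  qed
  note [measurable] = integrals.measurable[OF hk] integrals.measurable[OF h]
  define u where "u k w = (cmod (J n (hk k) w - J n h w))\<^sup>2" for k w
  have u_le: "(\<integral>\<^sup>+w. ennreal (u k w) \<partial>M) \<le> ennreal (fact n) * sqnorm n (\<lambda>x. hk k x - h x)" for k
    using J_dist_le[OF hk[of k] h] by (simp add: u_def ennreal_power)
  have u_int: "integrable M (u k)" for k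
  proof (rule integrableI_bounded)
    have "sqnorm n (\<lambda>x. hk k x - h x) < \<infinity>"
      using L2_kernels_diff[OF hk[of k] h] by (simp add: L2_kernels_iff)
    then have "ennreal (fact n) * sqnorm n (\<lambda>x. hk k x - h x) < \<infinity>"
      by (simp add: ennreal_mult_less_top)
    with u_le[of k] have "(\<integral>\<^sup>+w. ennreal (u k w) \<partial>M) < \<infinity>" by (rule le_less_trans)
    then show "(\<integral>\<^sup>+w. ennreal (norm (u k w)) \<partial>M) < \<infinity>" by (simp add: u_def)
  qed (simp add: u_def[abs_def])
  have "(\<lambda>k. ennreal (fact n) * sqnorm n (\<lambda>x. hk k x - h x)) \<longlonglongrightarrow> ennreal (fact n) * 0"
    by (intro ennreal_tendsto_cmult conv) simp
  then have lim: "(\<lambda>k. ennreal (fact n) * sqnorm n (\<lambda>x. hk k x - h x)) \<longlonglongrightarrow> 0"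
    by (simp only: mult_zero_right)
  have "(\<lambda>k. \<integral>\<^sup>+w. ennreal (u k w) \<partial>M) \<longlonglongrightarrow> 0"
  proof (rule tendsto_sandwich[OF _ _ tendsto_const lim])
    show "\<forall>\<^sub>F k in sequentially. (\<integral>\<^sup>+w. ennreal (u k w) \<partial>M) \<le> ennreal (fact n) * sqnorm n (\<lambda>x. hk k x - h x)"
      by (intro always_eventually allI u_le)
  qed simp
  then have "(\<lambda>k. enn2real (\<integral>\<^sup>+w. ennreal (u k w) \<partial>M)) \<longlonglongrightarrow> 0"
    by (intro tendsto_enn2real) simp_all
  moreover have "(\<integral>w. norm (u k w) \<partial>M) = enn2real (\<integral>\<^sup>+w. ennreal (u k w) \<partial>M)" for k
    by (subst integral_eq_nn_integral) (auto simp: u_def[abs_def])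
  ultimately have "(\<lambda>k. \<integral>w. norm (u k w) \<partial>M) \<longlonglongrightarrow> 0" by simp
  then obtain r :: "nat \<Rightarrow> nat" where r: "AE w in M. (\<lambda>k. u (r k) w) \<longlonglongrightarrow> 0"
    using tendsto_L1_AE_subseq[where u = u, OF u_int] by blast
  define Y where "Y w = lim (\<lambda>k. Z (r k) w)" for w
  have Y: "Y \<in> borel_measurable (local_sigma M \<eta> A)"
    unfolding Y_def by (rule borel_measurable_lim_metric[OF Z(1)])
  have "AE w in M. \<forall>k. J n (hk k) w = Z k w"
    unfolding AE_all_countable using Z(2) by blast
  with r have "AE w in M. J n h w = Y w"
  proof eventually_elim
    case (elim w)
    have "(\<lambda>k. sqrt (u (r k) w)) \<longlonglongrightarrow> sqrt 0" by (intro tendsto_real_sqrt elim(1))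
    moreover have "sqrt (u (r k) w) = norm (Z (r k) w - J n h w)" for k
      using elim(2) by (simp add: u_def)
    ultimately have "(\<lambda>k. norm (Z (r k) w - J n h w)) \<longlonglongrightarrow> 0" by (simp only: real_sqrt_zero)
    then have "(\<lambda>k. Z (r k) w) \<longlonglongrightarrow> J n h w"
      by (rule LIM_zero_cancel[OF tendsto_norm_zero_cancel])
    then show ?case unfolding Y_def by (rule limI[symmetric])
  qed
  with Y show ?thesis by (rule determined_onI)
qed

lemma L2_kernels_restrict:
  assumes "h \<in> L2_kernels n" "A \<in> sets half_line"
  shows "(\<lambda>x. h x * indicator (\<Pi>\<^sub>E i\<in>{..<n}. A) x) \<in> L2_kernels n"
proof (rule L2_kernels_dominated[OF assms(1), where c = 1])
  have "(\<Pi>\<^sub>E i\<in>{..<n}. A) \<in> sets (half_line_pow n)"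
    by (intro sets_half_line_pow_box assms)
  then show "(\<lambda>x. h x * indicator (\<Pi>\<^sub>E i\<in>{..<n}. A) x) \<in> borel_measurable (half_line_pow n)"
    using L2_kernels_measurable[OF assms(1)] by (intro borel_measurable_times borel_measurable_indicator)
qed (simp add: norm_mult indicator_def)

text \<open>Intersecting the sides of a box with \<open>A\<close> turns its integral into a product of compensated counts of
  subsets of \<open>A\<close>.\<close>
lemma determined_on_restrict:
  assumes h: "h \<in> L2_kernels n" and A: "A \<in> sets half_line"
  shows "determined_on A (J n (\<lambda>x. h x * indicator (\<Pi>\<^sub>E i\<in>{..<n}. A) x))"
  using h
proof (induction rule: L2_kernels_induct)
  case (add h h')
  let ?I = "indicator (\<Pi>\<^sub>E i\<in>{..<n}. A) :: kernel"
  obtain Z where Z: "Z \<in> borel_measurable (local_sigma M \<eta> A)" "AE w in M. J n (\<lambda>x. h x * ?I x) w = Z w"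
    using add(3) by (rule determined_onE)
  obtain Z' where Z': "Z' \<in> borel_measurable (local_sigma M \<eta> A)" "AE w in M. J n (\<lambda>x. h' x * ?I x) w = Z' w"
    using add(4) by (rule determined_onE)
  have "AE w in M. J n (\<lambda>x. h x * ?I x + h' x * ?I x) w = J n (\<lambda>x. h x * ?I x) w + J n (\<lambda>x. h' x * ?I x) w"
    by (intro integrals.add L2_kernels_restrict add A)
  with Z(2) Z'(2) have "AE w in M. J n (\<lambda>x. (h x + h' x) * ?I x) w = Z w + Z' w"
    unfolding distrib_right by eventually_elim simp
  then show ?case
    by (rule determined_onI[OF borel_measurable_add[OF Z(1) Z'(1)]])
next
  case (scale c h)
  let ?I = "indicator (\<Pi>\<^sub>E i\<in>{..<n}. A) :: kernel"
  obtain Z where Z: "Z \<in> borel_measurable (local_sigma M \<eta> A)" "AE w in M. J n (\<lambda>x. h x * ?I x) w = Z w"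
    using scale(2) by (rule determined_onE)
  have "AE w in M. J n (\<lambda>x. c * (h x * ?I x)) w = c * J n (\<lambda>x. h x * ?I x) w"
    by (intro integrals.scale L2_kernels_restrict scale A)
  with Z(2) have "AE w in M. J n (\<lambda>x. (c * h x) * ?I x) w = c * Z w"
    unfolding mult.assoc by eventually_elim simp
  then show ?case
    by (rule determined_onI[OF borel_measurable_times[OF borel_measurable_const Z(1)]])
next
  case (limit hk h)
  let ?I = "indicator (\<Pi>\<^sub>E i\<in>{..<n}. A) :: kernel"
  show ?case
  proof (rule determined_on_limit[OF L2_kernels_restrict[OF limit(1) A] L2_kernels_restrict[OF limit(2) A] _ limit(4)])
    show "(\<lambda>k. sqnorm n (\<lambda>x. hk k x * ?I x - h x * ?I x)) \<longlonglongrightarrow> 0"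
    proof (rule tendsto_sandwich[OF _ _ tendsto_const limit(3)])
      show "\<forall>\<^sub>F k in sequentially. sqnorm n (\<lambda>x. hk k x * ?I x - h x * ?I x) \<le> sqnorm n (\<lambda>x. hk k x - h x)"
        unfolding sqnorm_def
        by (intro always_eventually allI nn_integral_mono) (auto split: split_indicator)
    qed simp
  qed
next
  case (box B)
  have eq: "(\<lambda>x. indicator (\<Pi>\<^sub>E i\<in>{..<n}. B i) x * indicator (\<Pi>\<^sub>E i\<in>{..<n}. A) x) =
      (indicator (\<Pi>\<^sub>E i\<in>{..<n}. B i \<inter> A) :: kernel)"
    by (simp only: indicator_inter_arith[symmetric] PiE_Int)
  have fin: "emeasure half_line (B i \<inter> A) < \<infinity>" if "i < n" for i
  proof -
    have "emeasure half_line (B i \<inter> A) \<le> emeasure half_line (B i)"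
      using box(1)[OF that] by (intro emeasure_mono) auto
    also have "\<dots> < \<infinity>" using box(1)[OF that] by simp
    finally show ?thesis .
  qed
  have "AE w in M. J n (indicator (\<Pi>\<^sub>E i\<in>{..<n}. B i \<inter> A)) w =
      complex_of_real (\<Prod>i<n. compensated_measure \<eta> (B i \<inter> A) w)"
  proof (rule integrals.box)
    show "B i \<inter> A \<in> sets half_line \<and> emeasure half_line (B i \<inter> A) < \<infinity>" if "i < n" for i
      using box(1)[OF that] A fin[OF that] by (intro conjI sets.Int) simp_all
    show "disjoint_family_on (\<lambda>i. B i \<inter> A) {..<n}"
      using box(2) unfolding disjoint_family_on_def by blast
  qed
  moreover have Z: "(\<lambda>w. complex_of_real (\<Prod>i<n. compensated_measure \<eta> (B i \<inter> A) w)) \<in>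
      borel_measurable (local_sigma M \<eta> A)"
  proof (intro measurable_compose[OF _ borel_measurable_of_real] borel_measurable_prod)
    fix i assume "i \<in> {..<n}"
    then have "(\<lambda>w. emeasure (\<eta> w) (B i \<inter> A)) \<in> borel_measurable (local_sigma M \<eta> A)"
      using box(1) A by (intro measurable_count_local_sigma sets.Int) auto
    then show "(\<lambda>w. compensated_measure \<eta> (B i \<inter> A) w) \<in> borel_measurable (local_sigma M \<eta> A)"
      unfolding compensated_measure_def measure_def by measurable
  qed
  ultimately show ?case unfolding eq by (intro determined_onI[OF Z])
qed

lemma determined_on_support:
  assumes h: "h \<in> L2_kernels n" and A: "A \<in> sets half_line"
    and supp: "AE x in half_line_pow n. h x \<noteq> 0 \<longrightarrow> (\<forall>i<n. x i \<in> A)"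
  shows "determined_on A (J n h)"
proof -
  let ?h = "\<lambda>x. h x * indicator (\<Pi>\<^sub>E i\<in>{..<n}. A) x"
  have "AE x in half_line_pow n. h x = ?h x"
    using supp AE_space
    by eventually_elim (auto simp: space_half_line_pow PiE_iff indicator_def)
  then have J: "AE w in M. J n h w = J n ?h w"
    by (rule J_cong_AE[OF h L2_kernels_restrict[OF h A]])
  obtain Z where Z: "Z \<in> borel_measurable (local_sigma M \<eta> A)" "AE w in M. J n ?h w = Z w"
    using determined_on_restrict[OF h A] by (rule determined_onE)
  from J Z(2) have "AE w in M. J n h w = Z w" by eventually_elim simp
  with Z(1) show ?thesis by (rule determined_onI)
qed

lemma moment_independent_if_disjoint_supports:
  assumes f: "f \<in> L2_kernels n" "AE x in half_line_pow n. f x \<noteq> 0 \<longrightarrow> (\<forall>i<n. x i \<in> A)"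
    and g: "g \<in> L2_kernels m" "AE x in half_line_pow m. g x \<noteq> 0 \<longrightarrow> (\<forall>i<m. x i \<notin> A)"
    and A: "A \<in> sets half_line"
  shows "moment_independent M (J n f) (J m g)"
proof -
  let ?A' = "space half_line - A"
  have "AE x in half_line_pow m. g x \<noteq> 0 \<longrightarrow> (\<forall>i<m. x i \<in> ?A')"
    using g(2) AE_space by eventually_elim (auto simp: space_half_line_pow PiE_iff)
  then have "determined_on ?A' (J m g)"
    by (rule determined_on_support[OF g(1) sets.compl_sets[OF A]])
  then obtain Y where Y: "Y \<in> borel_measurable (local_sigma M \<eta> ?A')" "AE w in M. J m g w = Y w"
    by (rule determined_onE)
  obtain X where X: "X \<in> borel_measurable (local_sigma M \<eta> A)" "AE w in M. J n f w = X w"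
    using determined_on_support[OF f(1) A f(2)] by (rule determined_onE)
  have indep: "indep_var borel X borel Y"
    using X(1) Y(1) by (intro indep_var_local[of A ?A']) auto
  note [measurable] = integrals.measurable[OF f(1)] integrals.measurable[OF g(1)]
    indep_var_rv1[OF indep] indep_var_rv2[OF indep]
  show ?thesis
    unfolding moment_independent_def
  proof (intro allI impI)
    fix a b :: nat
    assume "integrable M (\<lambda>w. J n f w ^ a)" "integrable M (\<lambda>w. J m g w ^ b)"
    moreover have Xa: "AE w in M. J n f w ^ a = X w ^ a" and Yb: "AE w in M. J m g w ^ b = Y w ^ b"
      using X(2) Y(2) by (auto elim: eventually_mono)
    ultimately have int: "integrable M (\<lambda>w. X w ^ a)" "integrable M (\<lambda>w. Y w ^ b)"
      using integrable_cong_AE[OF _ _ Xa] integrable_cong_AE[OF _ _ Yb] by simp_all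
    have ind: "indep_var borel (\<lambda>w. X w ^ a) borel (\<lambda>w. Y w ^ b)"
      using indep_var_compose[OF indep, of "\<lambda>z. z ^ a" borel "\<lambda>z. z ^ b" borel] by (simp add: comp_def)
    have XY: "AE w in M. J n f w ^ a * J m g w ^ b = X w ^ a * Y w ^ b"
      using Xa Yb by eventually_elim simp
    show "integrable M (\<lambda>w. J n f w ^ a * J m g w ^ b) \<and>
      (\<integral>w. J n f w ^ a * J m g w ^ b \<partial>M) = (\<integral>w. J n f w ^ a \<partial>M) * (\<integral>w. J m g w ^ b \<partial>M)"
      using indep_var_integrable[OF ind int] indep_var_lebesgue_integral[OF ind int]
        integrable_cong_AE[OF _ _ XY] integral_cong_AE[OF _ _ XY]
        integral_cong_AE[OF _ _ Xa] integral_cong_AE[OF _ _ Yb] by simp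
  qed
qed

end

section \<open>Free multiple integrals and classical independence\<close>

theorem corollary5p4:
  fixes A :: "('h::complex_hilbert \<Rightarrow>\<^sub>L 'h) set"
    and \<phi> :: "('h \<Rightarrow>\<^sub>L 'h) \<Rightarrow> complex"
    and \<iota> :: "('h \<Rightarrow>\<^sub>L 'h) \<Rightarrow> 'l::complex_hilbert"
    and \<A> :: "real \<Rightarrow> ('h \<Rightarrow>\<^sub>L 'h) set"
    and N :: "real \<Rightarrow> ('h \<Rightarrow>\<^sub>L 'h)"
    and I :: "nat \<Rightarrow> kernel \<Rightarrow> 'l"
    and P :: "'l set"
    and mul :: "'l \<Rightarrow> 'l \<Rightarrow> 'l"
    and M :: "'w measure"
    and \<eta> :: "'w \<Rightarrow> real measure"
    and J :: "nat \<Rightarrow> kernel \<Rightarrow> 'w \<Rightarrow> complex"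
    and n m :: nat
    and f g :: kernel
  assumes "tracial_W_space A \<phi>"
    and "L2_completion A \<phi> \<iota>"
    and "free_poisson_process A \<phi> \<A> N"
    and "free_poisson_integral A \<iota> N I"
    and "free_poisson_algebra A \<iota> I P mul"
    and "poisson_random_measure M \<eta>"
    and "poisson_multiple_integral M \<eta> J"
    and "n \<ge> 1" and "m \<ge> 1"
    and "f \<in> L2_kernels n" and "symmetric_kernel n f"
    and "g \<in> L2_kernels m" and "symmetric_kernel m g"
    and "I n f \<in> P" and "I m g \<in> P"
    and "free_elements mul (\<iota> id_blinfun) (L2_trace \<iota>) (\<lambda>b::bool. if b then I n f else I m g)"
  shows "moment_independent M (J n f) (J m g)"
proof -
  interpret free: free_poisson_setting A \<iota> N I P mul
    using assms(4,5) by (rule free_poisson_setting.intro)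
  interpret classical: poisson_integral_setting M \<eta> J
    using assms(6,7) by (rule poisson_integral_setting.intro)
  have star: "AE x in half_line_pow (n + m - 1). star_contraction n m 1 f g x = 0"
    using assms(8-16) by (intro free.star_contraction_eq_0_if_free free.star_I_symmetric)
  obtain S where "S \<in> sets half_line"
    and "AE x in half_line_pow n. f x \<noteq> 0 \<longrightarrow> (\<forall>i<n. x i \<in> S)"
    and "AE x in half_line_pow m. g x \<noteq> 0 \<longrightarrow> (\<forall>i<m. x i \<notin> S)"
    using disjoint_supports[OF assms(8,10,11,9,12,13) star] .
  then show ?thesis
    using assms(10,12) by (intro classical.moment_independent_if_disjoint_supports)
qed

end
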